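(* Let $p$ be a proof in the one-sided sequent calculus of the sequent $A_1,\dots,A_n$. Then for all closed $\mathcal{L}^+$-terms $u_1:\langle A_1\rangle,\dots,u_n:\langle A_n\rangle$, writing $\vec u = u_1,\dots,u_n$, we have $$\vdash_{\mathsf{QF}} \mathcal{W}(A_1, F^p_1\vec u, u_1)\vee\cdots\vee \mathcal{W}(A_n, F^p_n\vec u, u_n).$$
   Context: Type theory. Fix a first-order vocabulary $\mathcal{L}$ with at least one individual constant $c$ and one unary predicate. Types: $U ::= \iota \mid \Box \mid U\times U \mid U \to U$. $\mathcal{L}^+$-terms: $\varepsilon:\Box$; $\mathcal{L}$-terms (individual variables = variables of type $\iota$) have type $\iota$; $(s,t):U\times V$; $\pi_i(s):U_i$ for $s:U_1\times U_2$; $\lambda x.t:U\to V$ for $x$ a variable of type $U$ and $t:V$; application $st:V$ for $s:U\to V,t:U$; $\mathrm{case}_B(u,v):U$ for $u,v:U$ and $B$ a proposition. Propositions are closed under $\vee,\neg$ and contain $R(t_1,\dots,t_n)$ ($R$ a relation symbol, $t_i:\iota$) and $u_1\equiv u_2$ ($u_1,u_2$ of the same type); $\to,\wedge,\leftrightarrow$ are abbreviations. Reduction $\longrightarrow$: compatible closure of $(\lambda x.u)v\to u[v/x]$, $\pi_1(u,v)\to u$, $\pi_2(u,v)\to v$, $f(\mathrm{case}_B(u,v))\to\mathrm{case}_B(fu,fv)$, $(\mathrm{case}_B(f,g))u\to\mathrm{case}_B(fu,gu)$. The calculus $\mathsf{QF}$ has axioms: all instances of propositional tautologies, $u\equiv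 v$ for convertible $u,v$, $B\to\mathrm{case}_B(u,v)\equiv u$ and $\neg B\to\mathrm{case}_B(u,v)\equiv v$; rules: modus ponens and substitution (from $B[u/x]$ and $u\equiv v$ infer $B[v/x]$). $\vdash_{\mathsf{QF}}$ denotes provability. Formulas are built from atoms $R(t_1,\dots,t_n)$ by $\vee,\neg,\exists$ (terms may be $\mathcal{L}^+$-terms of type $\iota$). Types of formulas: $[A]=\langle A\rangle=\Box$ for atomic $A$; $[\exists x A]=\iota\times\langle\neg A\rangle$; $\langle\exists xA\rangle = [\exists xA]\to[\neg A]$; $[\neg A] = (\langle A\rangle\to[A])\to\langle A\rangle$; $\langle\neg A\rangle = \langle A\rangle\to [A]$; $[A\vee B]=\langle\neg A\rangle\times\langle\neg B\rangle$; $\langle A\vee B\rangle = (\langle\neg A\rangle\to[\neg A])\times(\langle\neg B\rangle\to[\neg B])$. For each formula $A$, $E_A$ denotes a fixed closed term of type $[A]$. For closed $u:[A]$, $v:\langle A\rangle$: $\mathcal{W}(R(\vec t),u,v)=R(\vec t)$; $\mathcal{W}(\exists xA,u,v) = \mathcal{W}(A[\pi_1(u)/x], (\pi_2(u))((v(u))(\pi_2(u))), (v(u))(\pi_2(u)))$; with $a = ((\pi_1(v))(\pi_1(u)))(\pi_1(u))$, $b=((\pi_2(v))(\pi_2(u)))(\pi_2(u))$, $\mathcal{W}(A\vee B,u,v)=\mathcal{W}(A,(\pi_1(u))a,a)\vee \mathcal{W}(B,(\pi_2(u))b,b)$; $\mathcal{W}(\neg A,u,v) = \neg\,\mathcal{W}(A,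 v(u(v)), u(v))$. Sequent calculus. Sequents are finite multisets of formulas; formula occurrences are indexed, with the side context $\Gamma$ (of size $k=|\Gamma|$) occupying indices $1,\dots,k$ and the principal formula(s) coming after. Axiom $\mathsf{lem}$: $\neg A, A$. Rules: ($\vee$) from $\Gamma,A_i$ infer $\Gamma,A_1\vee A_2$ ($i=1,2$); ($\neg\vee$) from $\Gamma,\neg A$ and $\Delta,\neg B$ infer $\Gamma,\Delta,\neg(A\vee B)$; ($\exists$) from $\Gamma,A[t/x]$ infer $\Gamma,\exists xA$, $t$ an $\mathcal{L}$-term; ($\neg\exists$) from $\Gamma,\neg A[\alpha/x]$ infer $\Gamma,\neg\exists xA$, with eigenvariable $\alpha$ not in the conclusion; (c) from $\Gamma,A,A$ infer $\Gamma,A$; (w) from $\Gamma$ infer $\Gamma,A$; ($\neg\neg$) from $\Gamma,A$ infer $\Gamma,\neg\neg A$; (cut) from $\Gamma,A$ and $\Delta,\neg A$ infer $\Gamma,\Delta$. Proofs are assumed regular (each eigenvariable is introduced by exactly one $\neg\exists$-inference); $p[t/\alpha]$ denotes replacing $\alpha$ by the $\mathcal{L}^+$-term $t:\iota$ throughout $p$. Term transformers. For a proof $p$ of $A_1,\dots,A_n$ and each $i$, $F^p_i$ maps terms $u_1:\langle A_1\rangle,\dots,u_n:\langle A_n\rangle$ to a term $F^p_i\vec u:[A_i]$, defined by recursion on $p$ (bound variables $z,y$ have the types needed; $\vec u$ are the arguments for $\Gamma$, $\vec v$ for $\Delta$, $k=|\Gamma|$, $m=|\Delta|$): - lem ($\neg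 A$ at index 1, $A$ at index 2): $F^p_1uv=\lambda z.v$, $F^p_2uv=u(v)$. - w: $F^p_{k+1}\vec uv=E_A$; $F^p_i\vec uv=F^{p_0}_i\vec u$ for $i\le k$. - cut (premises $p_1$ of $\Gamma,A$, $p_2$ of $\Delta,\neg A$): let $h=\lambda z.F^{p_1}_{k+1}\vec uz$; for $k<i\le k+m$, $F^p_i\vec u\vec v=F^{p_2}_{i-k}\vec vh$; for $i\le k$, $F^p_i\vec u\vec v=F^{p_1}_i\vec u((F^{p_2}_{m+1}\vec vh)h)$. - c (premise $p_0$ of $\Gamma,A,A$): $F^p_{k+1}\vec uv=\mathrm{case}_W(F^{p_0}_{k+1}\vec uvv, F^{p_0}_{k+2}\vec uvv)$ where $W=\mathcal{W}(A,F^{p_0}_{k+1}\vec uvv,v)$; $F^p_i\vec uv=F^{p_0}_i\vec uvv$ for $i\le k$. - $\exists$ (premise $p_0$ of $\Gamma,A[t/x]$): $h=\lambda z.F^{p_0}_{k+1}\vec uz$; $F^p_{k+1}\vec uv=(t,h)$; $F^p_i\vec uv=F^{p_0}_i\vec u((v((t,h)))h)$ for $i\le k$. - $\neg\exists$ (premise $p_0$ of $\Gamma,\neg A[\alpha/x]$): $h=\lambda y.(F^{p_0}_{k+1}\vec u(\pi_2(y)))[\pi_1(y)/\alpha]$; $F^p_{k+1}\vec uv=\lambda z.h$; $F^p_i\vec uv=(F^{p_0}_i\vec u(\pi_2(v(h))))[\pi_1(v(h))/\alpha]$ for $i\le k$. - $\vee$ with premise $p_0$ of $\Gamma,A$: $q=(\lambda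 z.F^{p_0}_{k+1}\vec uz,\lambda z.E_B)$; $F^p_{k+1}\vec uv=q$; $F^p_i\vec uv=F^{p_0}_i\vec u(((\pi_1(v))(\pi_1(q)))(\pi_1(q)))$. With premise of $\Gamma,B$: $q=(\lambda z.E_A,\lambda z.F^{p_0}_{k+1}\vec uz)$; $F^p_{k+1}\vec uv=q$; $F^p_i\vec uv=F^{p_0}_i\vec u(((\pi_2(v))(\pi_2(q)))(\pi_2(q)))$. - $\neg\vee$ (premises $p_1$ of $\Gamma,\neg A$, $p_2$ of $\Delta,\neg B$, conclusion indexed $\Gamma,\Delta,\neg(A\vee B)$, last argument $w$): $q_1=\lambda z.F^{p_1}_{k+1}\vec uz$, $q_2=\lambda z.F^{p_2}_{m+1}\vec vz$, $q=\lambda z.(q_1,q_2)$; $F^p_{k+m+1}\vec u\vec vw=q$; for $k<i\le k+m$, $F^p_i\vec u\vec vw=F^{p_2}_{i-k}\vec v(\pi_2(w(q(w))))$; for $i\le k$, $F^p_i\vec u\vec vw=F^{p_1}_i\vec u(\pi_1(w(q(w))))$. - $\neg\neg$ (premise $p_0$ of $\Gamma,A$): $q=\lambda y.F^{p_0}_{k+1}\vec uy$; $F^p_{k+1}\vec uv=\lambda z.q$; $F^p_i\vec uv=F^{p_0}_i\vec u((v(q))q)$ for $i\le k$.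
   Formalization: QF also allows derivations from hypotheses with discharge, so substitution applies under hypotheses (with substitution on theorems only, the claim fails); regularity also requires each eigenvariable to occur only above its ¬∃-inference (otherwise the claim fails). *)

theory Defs
  imports "HOL-Combinatorics.Permutations"
begin

record ('f, 'r) vocab =
  farity :: "'f \<Rightarrow> nat"
  rarity :: "'r \<Rightarrow> nat"

text \<open>Individual constants are function symbols of arity 0.\<close>

definition vocabulary :: "('f, 'r) vocab \<Rightarrow> bool" where
  "vocabulary L \<longleftrightarrow> (\<exists>c. farity L c = 0) \<and> (\<exists>P. rarity L P = 1)"

datatype ty = Iota | Box | TProd ty ty (infixr "\<otimes>" 75) | TFun ty ty (infixr "\<rightarrow>\<^sub>t" 70)

text \<open>Bound variables are de Bruijn indices (\<open>Bnd\<close>); free variables \<open>Fv x U\<close> are named and carry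
  their type, so \<open>Fv x U\<close> and \<open>Fv x V\<close> are different variables when \<open>U\<close> and \<open>V\<close> differ.
  Function symbols apply to arbitrary terms of type \<open>Iota\<close>: such terms arise when a term is
  substituted for an individual variable of an \<open>L\<close>-term.\<close>

datatype ('f, 'r) trm =
    Bnd nat
  | Fv nat ty
  | Eps
  | Fn 'f "('f, 'r) trm list"
  | Pr "('f, 'r) trm" "('f, 'r) trm"
  | Pi1 "('f, 'r) trm"
  | Pi2 "('f, 'r) trm"
  | Lam ty "('f, 'r) trm"
  | App "('f, 'r) trm" "('f, 'r) trm" (infixl "\<bullet>" 90)
  | Case "('f, 'r) prp" "('f, 'r) trm" "('f, 'r) trm"
and ('f, 'r) prp =
    Rel 'r "('f, 'r) trm list"
  | Equ "('f, 'r) trm" "('f, 'r) trm"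
  | Or "('f, 'r) prp" "('f, 'r) prp"
  | Neg "('f, 'r) prp"

abbreviation Imp :: "('f, 'r) prp \<Rightarrow> ('f, 'r) prp \<Rightarrow> ('f, 'r) prp" where
  "Imp A B \<equiv> Or (Neg A) B"

inductive wt :: "('f, 'r) vocab \<Rightarrow> ty list \<Rightarrow> ('f, 'r) trm \<Rightarrow> ty \<Rightarrow> bool"
  and wfprp :: "('f, 'r) vocab \<Rightarrow> ty list \<Rightarrow> ('f, 'r) prp \<Rightarrow> bool"
  for L :: "('f, 'r) vocab" where
  wt_Bnd: "i < length e \<Longrightarrow> wt L e (Bnd i) (e ! i)"
| wt_Fv: "wt L e (Fv x U) U"
| wt_Eps: "wt L e Eps Box"
| wt_Fn: "length ts = farity L f \<Longrightarrow> \<forall>t \<in> set ts. wt L e t Iota \<Longrightarrow> wt L e (Fn f ts) Iota"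
| wt_Pr: "wt L e s U \<Longrightarrow> wt L e t V \<Longrightarrow> wt L e (Pr s t) (U \<otimes> V)"
| wt_Pi1: "wt L e s (U \<otimes> V) \<Longrightarrow> wt L e (Pi1 s) U"
| wt_Pi2: "wt L e s (U \<otimes> V) \<Longrightarrow> wt L e (Pi2 s) V"
| wt_Lam: "wt L (U # e) t V \<Longrightarrow> wt L e (Lam U t) (U \<rightarrow>\<^sub>t V)"
| wt_App: "wt L e s (U \<rightarrow>\<^sub>t V) \<Longrightarrow> wt L e t U \<Longrightarrow> wt L e (s \<bullet> t) V"
| wt_Case: "wfprp L e B \<Longrightarrow> wt L e u U \<Longrightarrow> wt L e v U \<Longrightarrow> wt L e (Case B u v) U"
| wf_Rel: "length ts = rarity L r \<Longrightarrow> \<forall>t \<in> set ts. wt L e t Iota \<Longrightarrow> wfprp L e (Rel r ts)"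
| wf_Equ: "wt L e u U \<Longrightarrow> wt L e v U \<Longrightarrow> wfprp L e (Equ u v)"
| wf_Or: "wfprp L e A \<Longrightarrow> wfprp L e B \<Longrightarrow> wfprp L e (Or A B)"
| wf_Neg: "wfprp L e A \<Longrightarrow> wfprp L e (Neg A)"

inductive lterm :: "('f, 'r) vocab \<Rightarrow> ('f, 'r) trm \<Rightarrow> bool" for L :: "('f, 'r) vocab" where
  "lterm L (Fv x Iota)"
| "length ts = farity L f \<Longrightarrow> \<forall>t \<in> set ts. lterm L t \<Longrightarrow> lterm L (Fn f ts)"

primrec fv :: "('f, 'r) trm \<Rightarrow> (nat \<times> ty) set"
  and fvp :: "('f, 'r) prp \<Rightarrow> (nat \<times> ty) set" where
  "fv (Bnd i) = {}"
| "fv (Fv x U) = {(x, U)}"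
| "fv Eps = {}"
| "fv (Fn f ts) = \<Union> (set (map fv ts))"
| "fv (Pr s t) = fv s \<union> fv t"
| "fv (Pi1 s) = fv s"
| "fv (Pi2 s) = fv s"
| "fv (Lam U t) = fv t"
| "fv (s \<bullet> t) = fv s \<union> fv t"
| "fv (Case B u v) = fvp B \<union> fv u \<union> fv v"
| "fvp (Rel r ts) = \<Union> (set (map fv ts))"
| "fvp (Equ u v) = fv u \<union> fv v"
| "fvp (Or A B) = fvp A \<union> fvp B"
| "fvp (Neg A) = fvp A"

definition closed_of_type :: "('f, 'r) vocab \<Rightarrow> ('f, 'r) trm \<Rightarrow> ty \<Rightarrow> bool" where
  "closed_of_type L t U \<longleftrightarrow> wt L [] t U \<and> fv t = {}"

text \<open>\<open>lift k\<close> increments the indices from \<open>k\<close> on.\<close>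

fun lift :: "nat \<Rightarrow> ('f, 'r) trm \<Rightarrow> ('f, 'r) trm"
  and liftp :: "nat \<Rightarrow> ('f, 'r) prp \<Rightarrow> ('f, 'r) prp" where
  "lift k (Bnd i) = (if i < k then Bnd i else Bnd (Suc i))"
| "lift k (Fv x U) = Fv x U"
| "lift k Eps = Eps"
| "lift k (Fn f ts) = Fn f (map (lift k) ts)"
| "lift k (Pr s t) = Pr (lift k s) (lift k t)"
| "lift k (Pi1 s) = Pi1 (lift k s)"
| "lift k (Pi2 s) = Pi2 (lift k s)"
| "lift k (Lam U t) = Lam U (lift (Suc k) t)"
| "lift k (s \<bullet> t) = lift k s \<bullet> lift k t"
| "lift k (Case B u v) = Case (liftp k B) (lift k u) (lift k v)"
| "liftp k (Rel r ts) = Rel r (map (lift k) ts)"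
| "liftp k (Equ u v) = Equ (lift k u) (lift k v)"
| "liftp k (Or A B) = Or (liftp k A) (liftp k B)"
| "liftp k (Neg A) = Neg (liftp k A)"

text \<open>\<open>inst k s t\<close> replaces the index \<open>k\<close> in \<open>t\<close> by \<open>s\<close> and decrements the larger indices.\<close>

fun inst :: "nat \<Rightarrow> ('f, 'r) trm \<Rightarrow> ('f, 'r) trm \<Rightarrow> ('f, 'r) trm"
  and instp :: "nat \<Rightarrow> ('f, 'r) trm \<Rightarrow> ('f, 'r) prp \<Rightarrow> ('f, 'r) prp" where
  "inst k s (Bnd i) = (if i < k then Bnd i else if i = k then s else Bnd (i - 1))"
| "inst k s (Fv x U) = Fv x U"
| "inst k s Eps = Eps"
| "inst k s (Fn f ts) = Fn f (map (inst k s) ts)"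
| "inst k s (Pr t u) = Pr (inst k s t) (inst k s u)"
| "inst k s (Pi1 t) = Pi1 (inst k s t)"
| "inst k s (Pi2 t) = Pi2 (inst k s t)"
| "inst k s (Lam U t) = Lam U (inst (Suc k) (lift 0 s) t)"
| "inst k s (t \<bullet> u) = inst k s t \<bullet> inst k s u"
| "inst k s (Case B u v) = Case (instp k s B) (inst k s u) (inst k s v)"
| "instp k s (Rel r ts) = Rel r (map (inst k s) ts)"
| "instp k s (Equ u v) = Equ (inst k s u) (inst k s v)"
| "instp k s (Or A B) = Or (instp k s A) (instp k s B)"
| "instp k s (Neg A) = Neg (instp k s A)"

text \<open>\<open>subst x U s t\<close> is the capture-avoiding substitution of \<open>s\<close> for the free variable \<open>Fv x U\<close>.\<close>

fun subst :: "nat \<Rightarrow> ty \<Rightarrow> ('f, 'r) trm \<Rightarrow> ('f, 'r) trm \<Rightarrow> ('f, 'r) trm"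
  and substp :: "nat \<Rightarrow> ty \<Rightarrow> ('f, 'r) trm \<Rightarrow> ('f, 'r) prp \<Rightarrow> ('f, 'r) prp" where
  "subst x U s (Bnd i) = Bnd i"
| "subst x U s (Fv y V) = (if y = x \<and> V = U then s else Fv y V)"
| "subst x U s Eps = Eps"
| "subst x U s (Fn f ts) = Fn f (map (subst x U s) ts)"
| "subst x U s (Pr t u) = Pr (subst x U s t) (subst x U s u)"
| "subst x U s (Pi1 t) = Pi1 (subst x U s t)"
| "subst x U s (Pi2 t) = Pi2 (subst x U s t)"
| "subst x U s (Lam V t) = Lam V (subst x U (lift 0 s) t)"
| "subst x U s (t \<bullet> u) = subst x U s t \<bullet> subst x U s u"
| "subst x U s (Case B u v) = Case (substp x U s B) (subst x U s u) (subst x U s v)"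
| "substp x U s (Rel r ts) = Rel r (map (subst x U s) ts)"
| "substp x U s (Equ u v) = Equ (subst x U s u) (subst x U s v)"
| "substp x U s (Or A B) = Or (substp x U s A) (substp x U s B)"
| "substp x U s (Neg A) = Neg (substp x U s A)"

inductive red :: "('f, 'r) trm \<Rightarrow> ('f, 'r) trm \<Rightarrow> bool"
  and redp :: "('f, 'r) prp \<Rightarrow> ('f, 'r) prp \<Rightarrow> bool" where
  red_beta: "red (Lam U u \<bullet> v) (inst 0 v u)"
| red_Pi1: "red (Pi1 (Pr u v)) u"
| red_Pi2: "red (Pi2 (Pr u v)) v"
| red_App_Case: "red (f \<bullet> Case B u v) (Case B (f \<bullet> u) (f \<bullet> v))"
| red_Case_App: "red (Case B f g \<bullet> u) (Case B (f \<bullet> u) (g \<bullet> u))"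
| "red t t' \<Longrightarrow> red (Fn f (ts @ t # us)) (Fn f (ts @ t' # us))"
| "red s s' \<Longrightarrow> red (Pr s t) (Pr s' t)"
| "red t t' \<Longrightarrow> red (Pr s t) (Pr s t')"
| "red s s' \<Longrightarrow> red (Pi1 s) (Pi1 s')"
| "red s s' \<Longrightarrow> red (Pi2 s) (Pi2 s')"
| "red t t' \<Longrightarrow> red (Lam U t) (Lam U t')"
| "red s s' \<Longrightarrow> red (s \<bullet> t) (s' \<bullet> t)"
| "red t t' \<Longrightarrow> red (s \<bullet> t) (s \<bullet> t')"
| "redp B B' \<Longrightarrow> red (Case B u v) (Case B' u v)"
| "red u u' \<Longrightarrow> red (Case B u v) (Case B u' v)"
| "red v v' \<Longrightarrow> red (Case B u v) (Case B u v')"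
| "red t t' \<Longrightarrow> redp (Rel r (ts @ t # us)) (Rel r (ts @ t' # us))"
| "red u u' \<Longrightarrow> redp (Equ u v) (Equ u' v)"
| "red v v' \<Longrightarrow> redp (Equ u v) (Equ u v')"
| "redp A A' \<Longrightarrow> redp (Or A B) (Or A' B)"
| "redp B B' \<Longrightarrow> redp (Or A B) (Or A B')"
| "redp A A' \<Longrightarrow> redp (Neg A) (Neg A')"

text \<open>Reduction is stated on raw terms; convertibility only passes through terms of the given type.\<close>

definition conv :: "('f, 'r) vocab \<Rightarrow> ty \<Rightarrow> ('f, 'r) trm \<Rightarrow> ('f, 'r) trm \<Rightarrow> bool" where
  "conv L U u v \<longleftrightarrow> wt L [] u U \<and>
     (\<lambda>s t. wt L [] s U \<and> wt L [] t U \<and> (red s t \<or> red t s))\<^sup>*\<^sup>* u v"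

datatype schema = PVar nat | POr schema schema | PNeg schema

primrec peval :: "(nat \<Rightarrow> bool) \<Rightarrow> schema \<Rightarrow> bool" where
  "peval \<nu> (PVar n) = \<nu> n"
| "peval \<nu> (POr \<phi> \<psi>) = (peval \<nu> \<phi> \<or> peval \<nu> \<psi>)"
| "peval \<nu> (PNeg \<phi>) = (\<not> peval \<nu> \<phi>)"

primrec pinst :: "(nat \<Rightarrow> ('f, 'r) prp) \<Rightarrow> schema \<Rightarrow> ('f, 'r) prp" where
  "pinst \<sigma> (PVar n) = \<sigma> n"
| "pinst \<sigma> (POr \<phi> \<psi>) = Or (pinst \<sigma> \<phi>) (pinst \<sigma> \<psi>)"
| "pinst \<sigma> (PNeg \<phi>) = Neg (pinst \<sigma> \<phi>)"

text \<open>\<open>QF L \<Sigma> B\<close>: \<open>B\<close> is derivable from the hypotheses \<open>\<Sigma>\<close>; provability is \<open>QF L {} B\<close>.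
  The rules, in particular substitution, apply to derivations from hypotheses, and hypotheses can
  be discharged. If substitution were restricted to premises provable without hypotheses, the
  interpretation of contraction would fail. The sequent \<open>\<not>(P c \<or> P d), \<exists>x. P x\<close>, proved by contracting
  the two instances \<open>P c\<close> and \<open>P d\<close>, yields, up to conversion,
  \<open>\<not>(P c \<or> P d) \<or> P (\<pi>\<^sub>1 (case\<^bsub>P c\<^esub> ((c, _), (d, _))))\<close>. Evaluate terms, including the conditions
  of \<open>case\<close>, in a standard model where \<open>P\<close> holds of \<open>d\<close> but not of \<open>c\<close>. Everything derivable with the
  restricted rule is then true in this model, and remains true if, at the level of propositions
  only, \<open>P\<close> is changed to hold of \<open>c\<close> but not of \<open>d\<close> and every \<open>u \<equiv> v\<close> is declared true; but the
  proposition above becomes false.\<close>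

inductive QF :: "('f, 'r) vocab \<Rightarrow> ('f, 'r) prp set \<Rightarrow> ('f, 'r) prp \<Rightarrow> bool"
  for L :: "('f, 'r) vocab" where
  QF_hyp: "B \<in> \<Sigma> \<Longrightarrow> QF L \<Sigma> B"
| QF_taut: "(\<forall>\<nu>. peval \<nu> \<phi>) \<Longrightarrow> wfprp L [] (pinst \<sigma> \<phi>) \<Longrightarrow> QF L \<Sigma> (pinst \<sigma> \<phi>)"
| QF_conv: "conv L U u v \<Longrightarrow> QF L \<Sigma> (Equ u v)"
| QF_case_true: "wfprp L [] B \<Longrightarrow> wt L [] u U \<Longrightarrow> wt L [] v U \<Longrightarrow>
    QF L \<Sigma> (Imp B (Equ (Case B u v) u))"
| QF_case_false: "wfprp L [] B \<Longrightarrow> wt L [] u U \<Longrightarrow> wt L [] v U \<Longrightarrow>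
    QF L \<Sigma> (Imp (Neg B) (Equ (Case B u v) v))"
| QF_mp: "QF L \<Sigma> A \<Longrightarrow> QF L \<Sigma> (Imp A B) \<Longrightarrow> QF L \<Sigma> B"
| QF_subst: "QF L \<Sigma> (substp x U u B) \<Longrightarrow> QF L \<Sigma> (Equ u v) \<Longrightarrow>
    wfprp L [] B \<Longrightarrow> wt L [] u U \<Longrightarrow> wt L [] v U \<Longrightarrow> QF L \<Sigma> (substp x U v B)"
| QF_discharge: "wfprp L [] A \<Longrightarrow> QF L (insert A \<Sigma>) B \<Longrightarrow> QF L \<Sigma> (Imp A B)"

text \<open>The empty disjunction is the falsum \<open>\<not>(\<epsilon> \<equiv> \<epsilon>)\<close>.\<close>

fun Disj :: "('f, 'r) prp list \<Rightarrow> ('f, 'r) prp" where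
  "Disj [] = Neg (Equ Eps Eps)"
| "Disj [B] = B"
| "Disj (B # Bs) = Or B (Disj Bs)"

text \<open>\<open>FEx\<close> binds the index 0, of type \<open>Iota\<close>.\<close>

datatype ('f, 'r) fm =
    FAtom 'r "('f, 'r) trm list"
  | FOr "('f, 'r) fm" "('f, 'r) fm"
  | FNeg "('f, 'r) fm"
  | FEx "('f, 'r) fm"

primrec wff :: "('f, 'r) vocab \<Rightarrow> ty list \<Rightarrow> ('f, 'r) fm \<Rightarrow> bool" where
  "wff L e (FAtom r ts) \<longleftrightarrow> length ts = rarity L r \<and> (\<forall>t \<in> set ts. wt L e t Iota)"
| "wff L e (FOr A B) \<longleftrightarrow> wff L e A \<and> wff L e B"
| "wff L e (FNeg A) \<longleftrightarrow> wff L e A"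
| "wff L e (FEx A) \<longleftrightarrow> wff L (Iota # e) A"

primrec fvf :: "('f, 'r) fm \<Rightarrow> (nat \<times> ty) set" where
  "fvf (FAtom r ts) = \<Union> (set (map fv ts))"
| "fvf (FOr A B) = fvf A \<union> fvf B"
| "fvf (FNeg A) = fvf A"
| "fvf (FEx A) = fvf A"

primrec instf :: "nat \<Rightarrow> ('f, 'r) trm \<Rightarrow> ('f, 'r) fm \<Rightarrow> ('f, 'r) fm" where
  "instf k s (FAtom r ts) = FAtom r (map (inst k s) ts)"
| "instf k s (FOr A B) = FOr (instf k s A) (instf k s B)"
| "instf k s (FNeg A) = FNeg (instf k s A)"
| "instf k s (FEx A) = FEx (instf (Suc k) (lift 0 s) A)"

text \<open>\<open>pos A\<close> is \<open>[A]\<close> and \<open>neg A\<close> is \<open>\<langle>A\<rangle>\<close>. Since \<open>\<not>A\<close> is not a subformula of \<open>\<exists>xA\<close> or \<open>A \<or> B\<close>,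
  the recursion goes through a weight of formulas.\<close>

primrec weight :: "('f, 'r) fm \<Rightarrow> nat" where
  "weight (FAtom r ts) = 0"
| "weight (FOr A B) = weight A + weight B + 2"
| "weight (FNeg A) = weight A + 1"
| "weight (FEx A) = weight A + 2"

function pos :: "('f, 'r) fm \<Rightarrow> ty" and neg :: "('f, 'r) fm \<Rightarrow> ty" where
  "pos (FAtom r ts) = Box"
| "pos (FOr A B) = neg (FNeg A) \<otimes> neg (FNeg B)"
| "pos (FNeg A) = (neg A \<rightarrow>\<^sub>t pos A) \<rightarrow>\<^sub>t neg A"
| "pos (FEx A) = Iota \<otimes> neg (FNeg A)"
| "neg (FAtom r ts) = Box"
| "neg (FOr A B) = (neg (FNeg A) \<rightarrow>\<^sub>t pos (FNeg A)) \<otimes> (neg (FNeg B) \<rightarrow>\<^sub>t pos (FNeg B))"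
| "neg (FNeg A) = neg A \<rightarrow>\<^sub>t pos A"
| "neg (FEx A) = pos (FEx A) \<rightarrow>\<^sub>t pos (FNeg A)"
  by pat_completeness auto
termination
  by (relation "measure (case_sum (\<lambda>A. 2 * weight A) (\<lambda>A. 2 * weight A + 1))") auto

lemma weight_instf [simp]: "weight (instf k s A) = weight A"
  by (induction A arbitrary: k s) auto

text \<open>\<open>W\<close> is defined on arbitrary terms: the transformer of a contraction applies it to open ones.\<close>

function W :: "('f, 'r) fm \<Rightarrow> ('f, 'r) trm \<Rightarrow> ('f, 'r) trm \<Rightarrow> ('f, 'r) prp" where
  "W (FAtom r ts) u v = Rel r ts"
| "W (FEx A) u v =
     W (instf 0 (Pi1 u) A) (Pi2 u \<bullet> (v \<bullet> u \<bullet> Pi2 u)) (v \<bullet> u \<bullet> Pi2 u)"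
| "W (FOr A B) u v =
     (let a = Pi1 v \<bullet> Pi1 u \<bullet> Pi1 u;
          b = Pi2 v \<bullet> Pi2 u \<bullet> Pi2 u
      in Or (W A (Pi1 u \<bullet> a) a) (W B (Pi2 u \<bullet> b) b))"
| "W (FNeg A) u v = Neg (W A (v \<bullet> (u \<bullet> v)) (u \<bullet> v))"
  by pat_completeness auto
termination
  by (relation "measure (\<lambda>(A, u, v). weight A)") auto

text \<open>A sequent is a multiset of formulas whose occurrences are indexed, that is, a list of formulas
  that may be permuted: \<open>PPerm\<close> re-indexes the occurrences. The arguments \<open>\<Gamma>\<close>, \<open>\<Delta>\<close>
  of the other constructors are the side contexts.\<close>

datatype ('f, 'r) deriv =
    PLem "('f, 'r) fm"
  | PPerm "nat \<Rightarrow> nat" "('f, 'r) deriv"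
  | POr1 "('f, 'r) fm list" "('f, 'r) fm" "('f, 'r) fm" "('f, 'r) deriv"
  | POr2 "('f, 'r) fm list" "('f, 'r) fm" "('f, 'r) fm" "('f, 'r) deriv"
  | PNegOr "('f, 'r) fm list" "('f, 'r) fm list" "('f, 'r) fm" "('f, 'r) fm"
      "('f, 'r) deriv" "('f, 'r) deriv"
  | PEx "('f, 'r) fm list" "('f, 'r) fm" "('f, 'r) trm" "('f, 'r) deriv"
  | PNegEx "('f, 'r) fm list" "('f, 'r) fm" nat "('f, 'r) deriv"
  | PContr "('f, 'r) fm list" "('f, 'r) fm" "('f, 'r) deriv"
  | PWeak "('f, 'r) fm list" "('f, 'r) fm" "('f, 'r) deriv"
  | PNegNeg "('f, 'r) fm list" "('f, 'r) fm" "('f, 'r) deriv"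
  | PCut "('f, 'r) fm list" "('f, 'r) fm list" "('f, 'r) fm" "('f, 'r) deriv" "('f, 'r) deriv"

inductive proof_of ::
  "('f, 'r) vocab \<Rightarrow> ('f, 'r) deriv \<Rightarrow> ('f, 'r) fm list \<Rightarrow> bool"
  for L :: "('f, 'r) vocab" where
  "wff L [] A \<Longrightarrow> proof_of L (PLem A) [FNeg A, A]"
| "proof_of L p S \<Longrightarrow> \<pi> permutes {..<length S} \<Longrightarrow>
     proof_of L (PPerm \<pi> p) (permute_list \<pi> S)"
| "proof_of L p (\<Gamma> @ [A]) \<Longrightarrow> wff L [] B \<Longrightarrow> proof_of L (POr1 \<Gamma> A B p) (\<Gamma> @ [FOr A B])"
| "proof_of L p (\<Gamma> @ [B]) \<Longrightarrow> wff L [] A \<Longrightarrow> proof_of L (POr2 \<Gamma> A B p) (\<Gamma> @ [FOr A B])"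
| "proof_of L p (\<Gamma> @ [FNeg A]) \<Longrightarrow> proof_of L q (\<Delta> @ [FNeg B]) \<Longrightarrow>
     proof_of L (PNegOr \<Gamma> \<Delta> A B p q) (\<Gamma> @ \<Delta> @ [FNeg (FOr A B)])"
| "proof_of L p (\<Gamma> @ [instf 0 t A]) \<Longrightarrow> lterm L t \<Longrightarrow> wff L [Iota] A \<Longrightarrow>
     proof_of L (PEx \<Gamma> A t p) (\<Gamma> @ [FEx A])"
| "proof_of L p (\<Gamma> @ [FNeg (instf 0 (Fv \<alpha> Iota) A)]) \<Longrightarrow> wff L [Iota] A \<Longrightarrow>
     (\<alpha>, Iota) \<notin> (\<Union>B \<in> set (\<Gamma> @ [FNeg (FEx A)]). fvf B) \<Longrightarrow>
     proof_of L (PNegEx \<Gamma> A \<alpha> p) (\<Gamma> @ [FNeg (FEx A)])"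
| "proof_of L p (\<Gamma> @ [A, A]) \<Longrightarrow> proof_of L (PContr \<Gamma> A p) (\<Gamma> @ [A])"
| "proof_of L p \<Gamma> \<Longrightarrow> wff L [] A \<Longrightarrow> proof_of L (PWeak \<Gamma> A p) (\<Gamma> @ [A])"
| "proof_of L p (\<Gamma> @ [A]) \<Longrightarrow> proof_of L (PNegNeg \<Gamma> A p) (\<Gamma> @ [FNeg (FNeg A)])"
| "proof_of L p (\<Gamma> @ [A]) \<Longrightarrow> proof_of L q (\<Delta> @ [FNeg A]) \<Longrightarrow>
     proof_of L (PCut \<Gamma> \<Delta> A p q) (\<Gamma> @ \<Delta>)"

text \<open>\<open>eigs p\<close>: the eigenvariables of \<open>p\<close>. \<open>vars p\<close>: all variables occurring free in a sequent of \<open>p\<close>,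
  in the witness of an \<open>\<exists>\<close>-inference, or as an eigenvariable; only what is not already contributed by
  the premises of an inference is added.\<close>

primrec eigs :: "('f, 'r) deriv \<Rightarrow> (nat \<times> ty) set" where
  "eigs (PLem A) = {}"
| "eigs (PPerm \<pi> p) = eigs p"
| "eigs (POr1 \<Gamma> A B p) = eigs p"
| "eigs (POr2 \<Gamma> A B p) = eigs p"
| "eigs (PNegOr \<Gamma> \<Delta> A B p q) = eigs p \<union> eigs q"
| "eigs (PEx \<Gamma> A t p) = eigs p"
| "eigs (PNegEx \<Gamma> A \<alpha> p) = insert (\<alpha>, Iota) (eigs p)"
| "eigs (PContr \<Gamma> A p) = eigs p"
| "eigs (PWeak \<Gamma> A p) = eigs p"
| "eigs (PNegNeg \<Gamma> A p) = eigs p"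
| "eigs (PCut \<Gamma> \<Delta> A p q) = eigs p \<union> eigs q"

primrec vars :: "('f, 'r) deriv \<Rightarrow> (nat \<times> ty) set" where
  "vars (PLem A) = fvf A"
| "vars (PPerm \<pi> p) = vars p"
| "vars (POr1 \<Gamma> A B p) = vars p \<union> fvf B"
| "vars (POr2 \<Gamma> A B p) = vars p \<union> fvf A"
| "vars (PNegOr \<Gamma> \<Delta> A B p q) = vars p \<union> vars q"
| "vars (PEx \<Gamma> A t p) = vars p \<union> fv t"
| "vars (PNegEx \<Gamma> A \<alpha> p) = insert (\<alpha>, Iota) (vars p)"
| "vars (PContr \<Gamma> A p) = vars p"
| "vars (PWeak \<Gamma> A p) = vars p \<union> fvf A"
| "vars (PNegNeg \<Gamma> A p) = vars p"
| "vars (PCut \<Gamma> \<Delta> A p q) = vars p \<union> vars q"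

text \<open>Regularity in the usual sense: each eigenvariable belongs to exactly one \<open>\<not>\<exists>\<close>-inference and
  occurs only above it.\<close>

primrec regular :: "('f, 'r) deriv \<Rightarrow> bool" where
  "regular (PLem A) \<longleftrightarrow> True"
| "regular (PPerm \<pi> p) \<longleftrightarrow> regular p"
| "regular (POr1 \<Gamma> A B p) \<longleftrightarrow> regular p \<and> eigs p \<inter> fvf B = {}"
| "regular (POr2 \<Gamma> A B p) \<longleftrightarrow> regular p \<and> eigs p \<inter> fvf A = {}"
| "regular (PNegOr \<Gamma> \<Delta> A B p q) \<longleftrightarrow>
     regular p \<and> regular q \<and> eigs p \<inter> vars q = {} \<and> vars p \<inter> eigs q = {}"
| "regular (PEx \<Gamma> A t p) \<longleftrightarrow> regular p \<and> eigs p \<inter> fv t = {}"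
| "regular (PNegEx \<Gamma> A \<alpha> p) \<longleftrightarrow> regular p \<and> (\<alpha>, Iota) \<notin> eigs p"
| "regular (PContr \<Gamma> A p) \<longleftrightarrow> regular p"
| "regular (PWeak \<Gamma> A p) \<longleftrightarrow> regular p \<and> eigs p \<inter> fvf A = {}"
| "regular (PNegNeg \<Gamma> A p) \<longleftrightarrow> regular p"
| "regular (PCut \<Gamma> \<Delta> A p q) \<longleftrightarrow>
     regular p \<and> regular q \<and> eigs p \<inter> vars q = {} \<and> vars p \<inter> eigs q = {}"

text \<open>\<open>Abs U G us w i\<close> is \<open>\<lambda>y. G\<^sub>i us w\<close>, with \<open>y\<close> of type \<open>U\<close> being index 0 in \<open>w\<close>. Lifting \<open>us\<close>
  prevents capture.\<close>

definition Abs :: "ty \<Rightarrow> (('f, 'r) trm list \<Rightarrow> nat \<Rightarrow> ('f, 'r) trm) \<Rightarrow>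
    ('f, 'r) trm list \<Rightarrow> ('f, 'r) trm \<Rightarrow> nat \<Rightarrow> ('f, 'r) trm" where
  "Abs U G us w i = Lam U (G (map (lift 0) us @ [w]) i)"

text \<open>\<open>F E p ws i\<close> is the \<open>i\<close>-th term transformer of \<open>p\<close> applied to \<open>ws\<close>, indices starting from 0;
  \<open>E A\<close> is the closed term fixed for the formula \<open>A\<close>; being closed, it is not lifted under a binder.\<close>

primrec F :: "(('f, 'r) fm \<Rightarrow> ('f, 'r) trm) \<Rightarrow> ('f, 'r) deriv \<Rightarrow>
    ('f, 'r) trm list \<Rightarrow> nat \<Rightarrow> ('f, 'r) trm" where
  "F E (PLem A) ws i =
     (let u = ws ! 0; v = ws ! 1
      in if i = 0 then Lam (neg (FNeg A)) (lift 0 v) else u \<bullet> v)"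
| "F E (PPerm \<pi> p) ws i = F E p (permute_list (inv \<pi>) ws) (\<pi> i)"
| "F E (POr1 \<Gamma> A B p) ws i =
     (let k = length \<Gamma>; us = take k ws; v = ws ! k;
          q = Pr (Abs (neg A) (F E p) us (Bnd 0) k) (Lam (neg B) (E B))
      in if i < k then F E p (us @ [Pi1 v \<bullet> Pi1 q \<bullet> Pi1 q]) i else q)"
| "F E (POr2 \<Gamma> A B p) ws i =
     (let k = length \<Gamma>; us = take k ws; v = ws ! k;
          q = Pr (Lam (neg A) (E A)) (Abs (neg B) (F E p) us (Bnd 0) k)
      in if i < k then F E p (us @ [Pi2 v \<bullet> Pi2 q \<bullet> Pi2 q]) i else q)"
| "F E (PNegOr \<Gamma> \<Delta> A B p p') ws i =
     (let k = length \<Gamma>; m = length \<Delta>;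
          us = take k ws; vs = take m (drop k ws); w = ws ! (k + m);
          q1 = Abs (neg (FNeg A)) (F E p) us (Bnd 0) k;
          q2 = Abs (neg (FNeg B)) (F E p') vs (Bnd 0) m;
          q = Lam (neg (FNeg (FOr A B))) (lift 0 (Pr q1 q2))
      in if i < k then F E p (us @ [Pi1 (w \<bullet> (q \<bullet> w))]) i
         else if i < k + m then F E p' (vs @ [Pi2 (w \<bullet> (q \<bullet> w))]) (i - k)
         else q)"
| "F E (PEx \<Gamma> A t p) ws i =
     (let k = length \<Gamma>; us = take k ws; v = ws ! k;
          h = Abs (neg A) (F E p) us (Bnd 0) k
      in if i < k then F E p (us @ [v \<bullet> Pr t h \<bullet> h]) i else Pr t h)"
| "F E (PNegEx \<Gamma> A \<alpha> p) ws i =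
     (let k = length \<Gamma>; us = take k ws; v = ws ! k;
          h = Abs (pos (FEx A)) (\<lambda>xs j. subst \<alpha> Iota (Pi1 (Bnd 0)) (F E p xs j))
                us (Pi2 (Bnd 0)) k
      in if i < k then subst \<alpha> Iota (Pi1 (v \<bullet> h)) (F E p (us @ [Pi2 (v \<bullet> h)]) i)
         else Lam (neg (FNeg (FEx A))) (lift 0 h))"
| "F E (PContr \<Gamma> A p) ws i =
     (let k = length \<Gamma>; us = take k ws; v = ws ! k;
          a = F E p (us @ [v, v]) k; b = F E p (us @ [v, v]) (k + 1)
      in if i < k then F E p (us @ [v, v]) i else Case (W A a v) a b)"
| "F E (PWeak \<Gamma> A p) ws i =
     (let k = length \<Gamma> in if i < k then F E p (take k ws) i else E A)"
| "F E (PNegNeg \<Gamma> A p) ws i =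
     (let k = length \<Gamma>; us = take k ws; v = ws ! k;
          q = Abs (neg A) (F E p) us (Bnd 0) k
      in if i < k then F E p (us @ [v \<bullet> q \<bullet> q]) i
         else Lam (neg (FNeg (FNeg A))) (lift 0 q))"
| "F E (PCut \<Gamma> \<Delta> A p q) ws i =
     (let k = length \<Gamma>; m = length \<Delta>; us = take k ws; vs = drop k ws;
          h = Abs (neg A) (F E p) us (Bnd 0) k
      in if i < k then F E p (us @ [F E q (vs @ [h]) m \<bullet> h]) i
         else F E q (vs @ [h]) (i - k))"

end

theory Submission
  imports Defs
begin

text \<open>By induction on the proof. Each transformer is chosen so that, after conversion, the principal
  disjunct of the conclusion follows from the principal disjuncts of the premises while the disjuncts
  of the side formulas are unchanged: a cut pairs \<open>W A r a\<close> with its negation, and a contraction is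
  settled by the case distinction on the condition of its \<open>case\<close> term. Conversion acts on a disjunct
  \<open>W A u v\<close> through the substitution rule, since \<open>u\<close> and \<open>v\<close> can be replaced by fresh variables. For
  \<open>\<not>\<exists>\<close> the premise is instantiated at its eigenvariable, which needs that provability is closed under
  substitution and, for the abstracted transformers, that plugging a term into the bound argument
  commutes with the transformer; the latter holds as long as the term avoids the eigenvariables, and
  regularity ensures that the terms arising in the proof do.\<close>

section \<open>Binding\<close>

text \<open>Call \<open>u\<close> in \<open>W A u v\<close> the response and \<open>v\<close> the
  challenge. The arguments that a transformer passes to its premise are dictated by the unfolding of
  \<open>W\<close>, which computes from \<open>u\<close> and \<open>v\<close> a challenge
  \<open>a\<close> for the component and then applies a part of \<open>u\<close> to
  \<open>a\<close>. For \<or> and \<exists> this part is \<open>h\<close>, the abstracted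
  transformer of the premise, and the premise is run at this very \<open>a\<close>: so
  \<open>h \<bullet> a\<close> is a redex that contracts to the premise's response to
  \<open>a\<close>. For \<not>\<or>, \<not>\<exists> and \<not>\<not> the response is a constant
  function with some value \<open>h\<close>, so \<open>u \<bullet> v\<close> converts to
  \<open>h\<close> and \<open>v \<bullet> (u \<bullet> v)\<close> to \<open>v \<bullet> h\<close>;
  the roles are exchanged, and \<open>v \<bullet> h\<close> supplies the challenge for the premise.
  A cut plays its premises against each other: \<open>h\<close> challenges \<not>A, and the answer
  applied to \<open>h\<close> challenges A. Only contraction needs an equation that is not a
  conversion, because it depends on the truth of the \<open>case\<close> condition; this is why
  equality and equivalence are developed relative to hypotheses.\<close>

lemma lift_lift:
  fixes t :: "('f, 'r) trm" and B :: "('f, 'r) prp"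
  shows "i \<le> k \<Longrightarrow> lift (Suc k) (lift i t) = lift i (lift k t)"
    and "i \<le> k \<Longrightarrow> liftp (Suc k) (liftp i B) = liftp i (liftp k B)"
  by (induction t and B arbitrary: i k and i k) auto

lemma inst_lift [simp]:
  fixes t :: "('f, 'r) trm" and B :: "('f, 'r) prp"
  shows "inst k s (lift k t) = t"
    and "instp k s (liftp k B) = B"
  by (induction t and B arbitrary: k s and k s) (auto intro: map_idI)

lemma inst_Suc_lift:
  fixes t :: "('f, 'r) trm" and B :: "('f, 'r) prp"
  shows "i \<le> k \<Longrightarrow> inst (Suc k) (lift i s) (lift i t) = lift i (inst k s t)"
    and "i \<le> k \<Longrightarrow> instp (Suc k) (lift i s) (liftp i B) = liftp i (instp k s B)"
  by (induction t and B arbitrary: i k s and i k s) (auto simp: lift_lift(1)[symmetric])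

lemma inst_inst:
  fixes t :: "('f, 'r) trm" and B :: "('f, 'r) prp"
  shows "j \<le> k \<Longrightarrow> inst k s (inst j r t) = inst j (inst k s r) (inst (Suc k) (lift j s) t)"
    and "j \<le> k \<Longrightarrow> instp k s (instp j r B) = instp j (inst k s r) (instp (Suc k) (lift j s) B)"
proof (induction t and B arbitrary: j k s r and j k s r)
  case (Lam U t)
  then show ?case by (simp add: lift_lift inst_Suc_lift)
qed auto

lemma subst_lift:
  fixes t :: "('f, 'r) trm" and B :: "('f, 'r) prp"
  shows "subst x U (lift k s) (lift k t) = lift k (subst x U s t)"
    and "substp x U (lift k s) (liftp k B) = liftp k (substp x U s B)"
  by (induction t and B arbitrary: k s and k s) (auto simp: lift_lift(1)[symmetric])

lemma subst_inst:
  fixes t :: "('f, 'r) trm" and B :: "('f, 'r) prp"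
  shows "subst x U r (inst k s t) = inst k (subst x U r s) (subst x U (lift k r) t)"
    and "substp x U r (instp k s B) = instp k (subst x U r s) (substp x U (lift k r) B)"
proof (induction t and B arbitrary: k r s and k r s)
  case (Lam V t)
  then show ?case by (simp add: lift_lift subst_lift)
qed auto

lemma fv_lift [simp]:
  fixes t :: "('f, 'r) trm" and B :: "('f, 'r) prp"
  shows "fv (lift k t) = fv t"
    and "fvp (liftp k B) = fvp B"
  by (induction t and B arbitrary: k and k) auto

lemma subst_fresh [simp]:
  fixes t :: "('f, 'r) trm" and B :: "('f, 'r) prp"
  shows "(x, U) \<notin> fv t \<Longrightarrow> subst x U s t = t"
    and "(x, U) \<notin> fvp B \<Longrightarrow> substp x U s B = B"
  by (induction t and B arbitrary: s and s) (auto intro!: map_idI)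

text \<open>The freshness condition is the source of all later conditions on eigenvariables: on the
  left \<open>s\<close> is inserted last and stays intact, on the right the substitution for
  \<open>x\<close> also runs over the inserted \<open>s\<close>.\<close>

lemma inst_subst:
  fixes t :: "('f, 'r) trm" and B :: "('f, 'r) prp"
  shows "(x, U) \<notin> fv s \<Longrightarrow> inst k s (subst x U r t) = subst x U (inst k s r) (inst k s t)"
    and "(x, U) \<notin> fv s \<Longrightarrow> instp k s (substp x U r B) = substp x U (inst k s r) (instp k s B)"
proof (induction t and B arbitrary: k r s and k r s)
  case (Lam V t)
  then show ?case by (simp add: inst_Suc_lift)
qed auto

lemma subst_subst:
  fixes t :: "('f, 'r) trm" and B :: "('f, 'r) prp"
  shows "(x, U) \<noteq> (y, V) \<Longrightarrow> (y, V) \<notin> fv s \<Longrightarrow>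
      subst x U s (subst y V r t) = subst y V (subst x U s r) (subst x U s t)"
    and "(x, U) \<noteq> (y, V) \<Longrightarrow> (y, V) \<notin> fv s \<Longrightarrow>
      substp x U s (substp y V r B) = substp y V (subst x U s r) (substp x U s B)"
proof (induction t and B arbitrary: r s and r s)
  case (Lam V t)
  then show ?case by (simp add: subst_lift)
qed auto

text \<open>Serves to exchange the variable that marks the replaced positions in a substitution step
  for one that is fresh for everything else in sight.\<close>

lemma subst_rename:
  fixes t :: "('f, 'r) trm" and B :: "('f, 'r) prp"
  shows "(y, U) \<notin> fv t \<Longrightarrow> subst y U s (subst x U (Fv y U) t) = subst x U s t"
    and "(y, U) \<notin> fvp B \<Longrightarrow> substp y U s (substp x U (Fv y U) B) = substp x U s B"
  by (induction t and B arbitrary: s and s) auto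

lemma fv_subst:
  fixes t :: "('f, 'r) trm" and B :: "('f, 'r) prp"
  shows "fv (subst x U s t) \<subseteq> fv t - {(x, U)} \<union> fv s"
    and "fvp (substp x U s B) \<subseteq> fvp B - {(x, U)} \<union> fv s"
  by (induction t and B arbitrary: s and s) (fastforce split: if_splits)+

lemma fv_inst:
  fixes t :: "('f, 'r) trm" and B :: "('f, 'r) prp"
  shows "fv (inst k s t) \<subseteq> fv t \<union> fv s"
    and "fvp (instp k s B) \<subseteq> fvp B \<union> fv s"
  by (induction t and B arbitrary: k s and k s) (fastforce split: if_splits)+

text \<open>Instantiation removes indices only, and these do not count as free variables. Hence what
  is known about the variables of A[t/x] in a premise carries over to A in the conclusion.\<close>

lemma fv_inst_superset:
  fixes t :: "('f, 'r) trm" and B :: "('f, 'r) prp"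
  shows "fv t \<subseteq> fv (inst k s t)"
    and "fvp B \<subseteq> fvp (instp k s B)"
  by (induction t and B arbitrary: k s and k s) fastforce+

lemma finite_fv [simp]:
  fixes t :: "('f, 'r) trm" and B :: "('f, 'r) prp"
  shows "finite (fv t)" and "finite (fvp B)"
  by (induction t and B) auto

lemma ex_fresh: "finite X \<Longrightarrow> \<exists>x. (x::nat, U::ty) \<notin> X"
proof -
  assume "finite X"
  then have "\<exists>x. x \<notin> fst ` X"
    by (simp add: ex_new_if_finite)
  then show ?thesis
    by (metis fst_conv image_eqI)
qed

section \<open>Typing\<close>

text \<open>\<open>wt_Bnd\<close> is left out, since a goal rarely shows its type in the form
  \<open>e ! i\<close>; the variant below has the lookup as an equation instead.\<close>

lemmas wt_intros = wt_wfprp.intros(2-)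

lemma wt_Bnd': "i < length e \<Longrightarrow> e ! i = U \<Longrightarrow> wt L e (Bnd i) U"
  using wt_Bnd by blast

lemma wt_lift_aux:
  shows "wt L e t U \<Longrightarrow> e = e1 @ e2 \<Longrightarrow> wt L (e1 @ V # e2) (lift (length e1) t) U"
    and "wfprp L e B \<Longrightarrow> e = e1 @ e2 \<Longrightarrow> wfprp L (e1 @ V # e2) (liftp (length e1) B)"
proof (induction arbitrary: e1 e2 and e1 e2 rule: wt_wfprp.inducts)
  case (wt_Bnd i e)
  then show ?case by (auto intro!: wt_Bnd' simp: nth_append)
next
  case (wt_Lam U e t V')
  from wt_Lam(2)[of "U # e1" e2] wt_Lam.prems show ?case by (auto intro!: wt_intros)
next
  case (wt_App e s U V' t)
  from wt_App(2,4)[OF wt_App.prems] show ?case by (auto intro: wt_intros)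
next
  case (wf_Equ e u U v)
  from wf_Equ(2,4)[OF wf_Equ.prems] show ?case by (auto intro: wt_intros)
qed (auto intro: wt_intros intro!: wt_Fn wf_Rel)

lemma wt_lift: "wt L e t U \<Longrightarrow> wt L (V # e) (lift 0 t) U"
  using wt_lift_aux(1)[of L e t U "[]" e V] by simp

text \<open>Indices count from the head of the context, so entries added at the far end require no
  lifting. Terms without loose indices can therefore be used unchanged below any number of
  binders.\<close>

lemma wt_append:
  shows "wt L e t U \<Longrightarrow> wt L (e @ e') t U"
    and "wfprp L e B \<Longrightarrow> wfprp L (e @ e') B"
proof (induction rule: wt_wfprp.inducts)
  case (wt_Bnd i e)
  then show ?case by (auto intro!: wt_Bnd' simp: nth_append)
qed (auto intro: wt_intros intro!: wt_Fn wf_Rel)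

lemma wt_Nil: "wt L [] t U \<Longrightarrow> wt L e t U"
  using wt_append(1)[of L "[]" t U e] by simp

lemma wt_inst_aux:
  shows "wt L e t U \<Longrightarrow> e = e1 @ V # e2 \<Longrightarrow> wt L (e1 @ e2) s V \<Longrightarrow>
      wt L (e1 @ e2) (inst (length e1) s t) U"
    and "wfprp L e B \<Longrightarrow> e = e1 @ V # e2 \<Longrightarrow> wt L (e1 @ e2) s V \<Longrightarrow>
      wfprp L (e1 @ e2) (instp (length e1) s B)"
proof (induction arbitrary: e1 e2 s and e1 e2 s rule: wt_wfprp.inducts)
  case (wt_Bnd i e)
  then show ?case by (auto intro!: wt_Bnd' simp: nth_append)
next
  case (wt_Lam U e t V')
  from wt_Lam(2)[of "U # e1" e2 "lift 0 s"] wt_Lam.prems show ?case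
    by (auto intro!: wt_intros wt_lift)
next
  case (wt_App e r U V' t)
  from wt_App(2,4)[OF wt_App.prems] show ?case by (auto intro: wt_intros)
next
  case (wf_Equ e u U v)
  from wf_Equ(2,4)[OF wf_Equ.prems] show ?case by (auto intro: wt_intros)
qed (auto intro: wt_intros intro!: wt_Fn wf_Rel)

lemma wt_inst: "wt L (V # e) t U \<Longrightarrow> wt L e s V \<Longrightarrow> wt L e (inst 0 s t) U"
  using wt_inst_aux(1)[of L "V # e" t U "[]" V e s] by simp

lemma wt_subst:
  shows "wt L e t U \<Longrightarrow> wt L e s V \<Longrightarrow> wt L e (subst x V s t) U"
    and "wfprp L e B \<Longrightarrow> wt L e s V \<Longrightarrow> wfprp L e (substp x V s B)"
  by (induction arbitrary: s and s rule: wt_wfprp.inducts)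
    (auto intro: wt_Bnd' wt_intros wt_lift intro!: wt_Fn wf_Rel)

text \<open>Typing in \<open>e\<close> bounds the loose indices by \<open>length e\<close>, so
  nothing is found at position \<open>k\<close>. This keeps the default terms \<open>E B\<close>,
  the \<exists>-witnesses and the sequent formulas fixed when a term is plugged into a
  transformer.\<close>

lemma inst_wt:
  shows "wt L e t U \<Longrightarrow> length e \<le> k \<Longrightarrow> inst k s t = t"
    and "wfprp L e B \<Longrightarrow> length e \<le> k \<Longrightarrow> instp k s B = B"
  by (induction arbitrary: k s and k s rule: wt_wfprp.inducts) (auto intro!: map_idI)

lemma wt_lterm: "lterm L t \<Longrightarrow> wt L e t Iota"
  by (induction rule: lterm.induct) (auto intro: wt_intros)

section \<open>Formulas: instantiation, substitution and the proposition \<open>W\<close>\<close>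

lemma wff_append: "wff L e A \<Longrightarrow> wff L (e @ e') A"
  by (induction A arbitrary: e) (auto intro: wt_append simp flip: append_Cons)

lemma wff_Nil: "wff L [] A \<Longrightarrow> wff L e A"
  using wff_append[of L "[]" A e] by simp

lemma wff_instf_aux:
  "wff L (e1 @ Iota # e2) A \<Longrightarrow> wt L (e1 @ e2) s Iota \<Longrightarrow> wff L (e1 @ e2) (instf (length e1) s A)"
proof (induction A arbitrary: e1 s)
  case (FAtom r ts)
  then show ?case by (auto intro: wt_inst_aux(1))
next
  case (FEx A)
  from FEx.IH[of "Iota # e1" "lift 0 s"] FEx.prems show ?case by (simp add: wt_lift)
qed auto

lemma wff_instf: "wff L (Iota # e) A \<Longrightarrow> wt L e s Iota \<Longrightarrow> wff L e (instf 0 s A)"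
  using wff_instf_aux[of L "[]" e A s] by simp

lemma instf_wff: "wff L e A \<Longrightarrow> length e \<le> k \<Longrightarrow> instf k s A = A"
  by (induction A arbitrary: e k s) (auto intro!: map_idI inst_wt)

lemma instf_instf:
  "j \<le> k \<Longrightarrow> instf k s (instf j r A) = instf j (inst k s r) (instf (Suc k) (lift j s) A)"
  by (induction A arbitrary: j k s r) (auto simp: inst_inst inst_Suc_lift lift_lift)

lemma fvf_instf: "fvf (instf k s A) \<subseteq> fvf A \<union> fv s"
proof (induction A arbitrary: k s)
  case (FAtom r ts)
  then show ?case using fv_inst by fastforce
next
  case (FEx A)
  from FEx.IH[of "Suc k" "lift 0 s"] show ?case by simp
qed fastforce+

lemma fvf_instf_superset: "fvf A \<subseteq> fvf (instf k s A)"
proof (induction A arbitrary: k s)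
  case (FAtom r ts)
  then show ?case using fv_inst_superset by fastforce
qed fastforce+

lemma finite_fvf [simp]: "finite (fvf A)"
  by (induction A) auto

text \<open>Needed to say how a substitution passes through \<open>W\<close>, whose formula argument
  may itself contain the replaced variable.\<close>

primrec substf :: "nat \<Rightarrow> ty \<Rightarrow> ('f, 'r) trm \<Rightarrow> ('f, 'r) fm \<Rightarrow> ('f, 'r) fm" where
  "substf x U s (FAtom r ts) = FAtom r (map (subst x U s) ts)"
| "substf x U s (FOr A B) = FOr (substf x U s A) (substf x U s B)"
| "substf x U s (FNeg A) = FNeg (substf x U s A)"
| "substf x U s (FEx A) = FEx (substf x U (lift 0 s) A)"

lemma substf_fresh [simp]: "(x, U) \<notin> fvf A \<Longrightarrow> substf x U s A = A"
  by (induction A arbitrary: s) (auto intro!: map_idI)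

lemma substf_instf:
  "substf x U r (instf k s A) = instf k (subst x U r s) (substf x U (lift k r) A)"
  by (induction A arbitrary: k r s) (auto simp: subst_inst subst_lift lift_lift)

text \<open>The types see only the logical skeleton. Thus A and all its instances take the same
  arguments, although the recursion of \<open>W\<close> at \<exists> moves to an instance that
  depends on the response.\<close>

lemma pos_neg_instf [simp]: "pos (instf k s A) = pos A \<and> neg (instf k s A) = neg A"
  by (induction A arbitrary: k s) auto

lemma wf_W:
  "wff L e A \<Longrightarrow> wt L e u (pos A) \<Longrightarrow> wt L e v (neg A) \<Longrightarrow> wfprp L e (W A u v)"
proof (induction A u v rule: W.induct)
  case (1 r ts u v)
  then show ?case by (auto intro: wt_intros)
next
  case (2 A u v)
  from 2(3) have "wt L e (Pi1 u) Iota" "wt L e (Pi2 u) (neg (FNeg A))"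
    by (auto intro: wt_intros)
  moreover from this(2) 2(3,4) have "wt L e (v \<bullet> u \<bullet> Pi2 u) (neg A)"
    by (auto intro: wt_intros)
  ultimately show ?case
    using 2(1,2) by (auto intro!: wt_intros wff_instf)
next
  case (3 A B u v)
  then have u: "wt L e (Pi1 u) (neg (FNeg A))" "wt L e (Pi2 u) (neg (FNeg B))"
    by (auto intro: wt_intros)
  with 3(4,5) have "wt L e (Pi1 v \<bullet> Pi1 u \<bullet> Pi1 u) (neg A)" "wt L e (Pi2 v \<bullet> Pi2 u \<bullet> Pi2 u) (neg B)"
    by (auto intro!: wt_intros)
  with 3 u show ?case
    by (auto simp: Let_def intro!: wt_intros)
next
  case (4 A u v)
  from 4(3,4) have "wt L e (u \<bullet> v) (neg A)"
    by (auto intro: wt_intros)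
  with 4 show ?case
    by (auto intro!: wt_intros)
qed

lemma instp_W: "instp k s (W A u v) = W (instf k s A) (inst k s u) (inst k s v)"
  by (induction A u v rule: W.induct) (auto simp: Let_def instf_instf)

text \<open>\<open>W\<close> merely recombines its term arguments by projection and application; the
  one term that enters the formula, \<open>Pi1 u\<close> at \<exists>, is handled by
  \<open>substf_instf\<close>. This makes \<open>W A u v\<close> an instance of a proposition with
  variables in place of \<open>u\<close> and \<open>v\<close>, so that the substitution rule applies
  without an induction on A.\<close>

lemma substp_W: "substp x U s (W A u v) = W (substf x U s A) (subst x U s u) (subst x U s v)"
  by (induction A u v rule: W.induct) (auto simp: Let_def substf_instf)

lemma fvp_W: "fvp (W A u v) \<subseteq> fvf A \<union> fv u \<union> fv v"
proof (induction A u v rule: W.induct)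
  case (2 A u v)
  then show ?case using fvf_instf[of 0 "Pi1 u" A] by auto
next
  case (3 A B u v)
  from 3[OF refl refl] show ?case by (simp add: Let_def) blast
qed auto

section \<open>The term transformers\<close>

lemma wff_proof: "proof_of L p S \<Longrightarrow> A \<in> set S \<Longrightarrow> wff L [] A"
proof -
  have "proof_of L p S \<Longrightarrow> \<forall>A \<in> set S. wff L [] A"
    by (induction rule: proof_of.induct) auto
  then show "proof_of L p S \<Longrightarrow> A \<in> set S \<Longrightarrow> wff L [] A"
    by blast
qed

text \<open>The eigenvariable condition removes the variable from the sequent at its
  \<not>\<exists>-inference, and regularity keeps other parts of the proof from bringing it back.
  This matters for the \<open>case\<close> condition of a contraction, through which a formula of
  the sequent enters a term.\<close>

lemma fvf_proof: "proof_of L p S \<Longrightarrow> regular p \<Longrightarrow> A \<in> set S \<Longrightarrow> fvf A \<subseteq> vars p - eigs p"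
proof (induction arbitrary: A rule: proof_of.induct)
  case (2 p S \<pi>)
  then show ?case by simp
next
  case (6 p \<Gamma> t B)
  have "fvf B \<subseteq> vars p - eigs p"
    using 6(4)[of "instf 0 t B"] 6(5) fvf_instf_superset[of B 0 t] by simp
  moreover have "A \<in> set \<Gamma> \<or> A = FEx B"
    using 6 by auto
  ultimately show ?case
    using 6 by fastforce
next
  case (7 p \<Gamma> \<alpha> B)
  have "fvf B \<subseteq> vars p - eigs p"
    using 7(4)[of "FNeg (instf 0 (Fv \<alpha> Iota) B)"] 7(5) fvf_instf_superset[of B 0 "Fv \<alpha> Iota"] by simp
  moreover have "A \<in> set \<Gamma> \<or> A = FNeg (FEx B)"
    using 7 by auto
  ultimately show ?case
    using 7 by fastforce
qed fastforce+

lemma fv_Abs [simp]: "fv (Abs U G us w i) = fv (G (map (lift 0) us @ [w]) i)"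
  by (simp add: Abs_def)

lemma wt_Abs:
  "wt L (U # e) (G (map (lift 0) us @ [w]) i) V \<Longrightarrow> wt L e (Abs U G us w i) (U \<rightarrow>\<^sub>t V)"
  by (simp add: Abs_def wt_intros)

text \<open>The second assumption is meant for \<open>Bnd 0\<close> and \<open>Pi2 (Bnd 0)\<close>:
  under the binder the instantiated index is at least 1, so the abstracted argument is not
  touched.\<close>

lemma inst_Abs:
  assumes "\<And>w. inst (Suc k) (lift 0 s) (G (map (lift 0) us @ [w]) i) =
      G (map (inst (Suc k) (lift 0 s)) (map (lift 0) us @ [w])) i"
    and "inst (Suc k) (lift 0 s) w = w"
  shows "inst k s (Abs U G us w i) = Abs U G (map (inst k s) us) w i"
proof -
  have "map (inst (Suc k) (lift 0 s)) (map (lift 0) us @ [w]) = map (lift 0) (map (inst k s) us) @ [w]"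
    using assms(2) by (simp add: inst_Suc_lift)
  with assms(1)[of w] show ?thesis by (simp only: Abs_def inst.simps)
qed

section \<open>Argument lists of the transformers\<close>

abbreviation fvs :: "('f, 'r) trm list \<Rightarrow> (nat \<times> ty) set" where
  "fvs ws \<equiv> \<Union> (fv ` set ws)"

lemma length_append_singleton_cases:
  assumes "length ws = length (\<Gamma> @ [A])"
  obtains us v where "ws = us @ [v]" "length us = length \<Gamma>"
  using assms by (cases ws rule: rev_cases) auto

lemma length_append_cases:
  assumes "length ws = length (\<Gamma> @ \<Delta>)"
  obtains us vs where "ws = us @ vs" "length us = length \<Gamma>" "length vs = length \<Delta>"
  using assms by (metis append_take_drop_id length_append length_drop length_take add_diff_cancel_left'
      le_add1 min.absorb2)

abbreviation wts :: "('f, 'r) vocab \<Rightarrow> ty list \<Rightarrow> ('f, 'r) trm list \<Rightarrow> ('f, 'r) fm list \<Rightarrow> bool" where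
  "wts L e \<equiv> list_all2 (\<lambda>w A. wt L e w (neg A))"

lemma wts_lift: "wts L e us \<Gamma> \<Longrightarrow> wts L (U # e) (map (lift 0) us) \<Gamma>"
  by (auto simp: list_all2_conv_all_nth intro: wt_lift)

lemma wts_append_singleton: "wts L e us \<Gamma> \<Longrightarrow> wt L e v (neg A) \<Longrightarrow> wts L e (us @ [v]) (\<Gamma> @ [A])"
  by (simp add: list_all2_appendI)

lemma wts_append_singleton_cases:
  assumes "wts L e ws (\<Gamma> @ [A])"
  obtains us v where "ws = us @ [v]" "length us = length \<Gamma>" "wts L e us \<Gamma>" "wt L e v (neg A)"
  using assms by (auto simp: list_all2_append2 list_all2_Cons2)

lemma wts_append_cases:
  assumes "wts L e ws (\<Gamma> @ \<Delta>)"
  obtains us vs where "ws = us @ vs" "length us = length \<Gamma>" "length vs = length \<Delta>"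
    "wts L e us \<Gamma>" "wts L e vs \<Delta>"
  using assms by (auto simp: list_all2_append2)

lemma permutes_less: "\<pi> permutes {..<n::nat} \<Longrightarrow> i < n \<Longrightarrow> \<pi> i < n"
  using permutes_in_image[of \<pi> "{..<n}" i] by simp

text \<open>Position \<open>i\<close> of the conclusion is position \<open>\<pi> i\<close> of the
  premise, so the arguments have to travel back along \<open>inv \<pi>\<close>.\<close>

lemma wts_permute_inv:
  assumes "\<pi> permutes {..<length S}" "wts L e ws (permute_list \<pi> S)"
  shows "wts L e (permute_list (inv \<pi>) ws) S"
  unfolding list_all2_conv_all_nth
proof (intro conjI allI impI)
  show len: "length (permute_list (inv \<pi>) ws) = length S"
    using assms(2) by (simp add: list_all2_lengthD)
  fix j assume "j < length (permute_list (inv \<pi>) ws)"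
  then have j: "inv \<pi> j < length S" "j < length S"
    using len permutes_less[OF permutes_inv[OF assms(1)]] by auto
  then have "wt L e (ws ! inv \<pi> j) (neg (permute_list \<pi> S ! inv \<pi> j))"
    using list_all2_nthD2[OF assms(2)] by simp
  then show "wt L e (permute_list (inv \<pi>) ws ! j) (neg (S ! j))"
    using j assms(1) len by (simp add: permute_list_nth permutes_inv permutes_inverses)
qed

lemma F_NegOr:
  assumes "length us = length \<Gamma>" "length vs = length \<Delta>"
    and "q1 = Abs (neg (FNeg A)) (F E p) us (Bnd 0) (length \<Gamma>)"
    and "q2 = Abs (neg (FNeg B)) (F E p') vs (Bnd 0) (length \<Delta>)"
    and "q = Lam (neg (FNeg (FOr A B))) (lift 0 (Pr q1 q2))"
  shows "F E (PNegOr \<Gamma> \<Delta> A B p p') (us @ vs @ [w]) i =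
    (if i < length \<Gamma> then F E p (us @ [Pi1 (w \<bullet> (q \<bullet> w))]) i
     else if i < length \<Gamma> + length \<Delta> then F E p' (vs @ [Pi2 (w \<bullet> (q \<bullet> w))]) (i - length \<Gamma>)
     else q)"
  unfolding assms(3-5) using assms(1,2) by (simp add: Let_def nth_append)

section \<open>Free variables, types and instantiation of the transformers\<close>

locale inhabited =
  fixes L :: "('f, 'r) vocab" and E :: "('f, 'r) fm \<Rightarrow> ('f, 'r) trm"
  assumes closed_E: "wff L [] B \<Longrightarrow> closed_of_type L (E B) (pos B)"
begin

lemma wt_E: "wff L [] B \<Longrightarrow> wt L e (E B) (pos B)"
  and fv_E: "wff L [] B \<Longrightarrow> fv (E B) = {}"
  and inst_E: "wff L [] B \<Longrightarrow> inst k s (E B) = E B"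
  using closed_E[of B] by (auto simp: closed_of_type_def intro: wt_Nil inst_wt(1))

text \<open>An eigenvariable gets into a transformer only above its \<not>\<exists>-inference, where
  it is then substituted away. The bound is what shows that arguments built from one premise avoid
  the eigenvariables of the other.\<close>

lemma fv_F:
  "proof_of L p S \<Longrightarrow> regular p \<Longrightarrow> length ws = length S \<Longrightarrow> i < length S \<Longrightarrow>
    fv (F E p ws i) \<subseteq> vars p - eigs p \<union> fvs ws"
proof (induction arbitrary: ws i rule: proof_of.induct)
  case (1 A)
  then show ?case by (auto simp: Let_def length_Suc_conv)
next
  case (2 p S \<pi>)
  have "fv (F E p (permute_list (inv \<pi>) ws) (\<pi> i)) \<subseteq> vars p - eigs p \<union> fvs (permute_list (inv \<pi>) ws)"
    using 2 by (intro 2(3)) (auto simp: permutes_less)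
  moreover have "inv \<pi> permutes {..<length ws}"
    using 2 by (simp add: permutes_inv)
  ultimately show ?case by simp
next
  case (3 p \<Gamma> A B)
  obtain us v where ws: "ws = us @ [v]" "length us = length \<Gamma>"
    using 3(5) by (elim length_append_singleton_cases) auto
  have IH: "z \<in> fv (F E p xs j) \<Longrightarrow> length xs = Suc (length \<Gamma>) \<Longrightarrow> j < Suc (length \<Gamma>) \<Longrightarrow>
      z \<in> vars p - eigs p \<union> fvs xs" for z xs j
    using 3(3)[of xs j] 3(4) by auto
  show ?case
    using 3(2,4,6) ws by (auto simp: Let_def nth_append fv_E dest!: IH)
next
  case (4 p \<Gamma> B A)
  obtain us v where ws: "ws = us @ [v]" "length us = length \<Gamma>"
    using 4(5) by (elim length_append_singleton_cases) auto
  have IH: "z \<in> fv (F E p xs j) \<Longrightarrow> length xs = Suc (length \<Gamma>) \<Longrightarrow> j < Suc (length \<Gamma>) \<Longrightarrow>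
      z \<in> vars p - eigs p \<union> fvs xs" for z xs j
    using 4(3)[of xs j] 4(4) by auto
  show ?case
    using 4(2,4,6) ws by (auto simp: Let_def nth_append fv_E dest!: IH)
next
  case (5 p \<Gamma> A q \<Delta> B)
  obtain us vs w where ws: "ws = us @ vs @ [w]" "length us = length \<Gamma>" "length vs = length \<Delta>"
    using 5(6) by (elim length_append_cases length_append_singleton_cases) auto
  \<comment> \<open>By regularity the variables of each premise are disjoint from the eigenvariables
    of the other, so both sets of eigenvariables can be subtracted.\<close>
  have IHp: "z \<in> fv (F E p xs j) \<Longrightarrow> length xs = Suc (length \<Gamma>) \<Longrightarrow> j < Suc (length \<Gamma>) \<Longrightarrow>
      z \<in> vars p - eigs p - eigs q \<union> fvs xs" for z xs j
    using 5(3)[of xs j] 5(5) by auto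
  have IHq: "z \<in> fv (F E q xs j) \<Longrightarrow> length xs = Suc (length \<Delta>) \<Longrightarrow> j < Suc (length \<Delta>) \<Longrightarrow>
      z \<in> vars q - eigs p - eigs q \<union> fvs xs" for z xs j
    using 5(4)[of xs j] 5(5) by auto
  show ?case
    using 5(7) ws by (auto simp: Let_def nth_append dest!: IHp IHq)
next
  case (6 p \<Gamma> t A)
  obtain us v where ws: "ws = us @ [v]" "length us = length \<Gamma>"
    using 6(6) by (elim length_append_singleton_cases) auto
  have IH: "z \<in> fv (F E p xs j) \<Longrightarrow> length xs = Suc (length \<Gamma>) \<Longrightarrow> j < Suc (length \<Gamma>) \<Longrightarrow>
      z \<in> vars p - eigs p \<union> fvs xs" for z xs j
    using 6(4)[of xs j] 6(5) by auto
  show ?case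
    using 6(5,7) ws by (auto simp: Let_def nth_append disjoint_iff dest!: IH)
next
  case (7 p \<Gamma> \<alpha> A)
  obtain us v where ws: "ws = us @ [v]" "length us = length \<Gamma>"
    using 7(6) by (elim length_append_singleton_cases) auto
  have IH: "z \<in> fv (subst \<alpha> Iota s (F E p xs j)) \<Longrightarrow> length xs = Suc (length \<Gamma>) \<Longrightarrow>
      j < Suc (length \<Gamma>) \<Longrightarrow> z \<in> vars p - insert (\<alpha>, Iota) (eigs p) \<union> fvs xs \<union> fv s" for z xs s j
    using fv_subst(1)[of \<alpha> Iota s "F E p xs j"] 7(4)[of xs j] 7(5) by auto
  show ?case
    using 7(7) ws by (auto simp: Let_def nth_append dest!: IH)
next
  case (8 p \<Gamma> A)
  obtain us v where ws: "ws = us @ [v]" "length us = length \<Gamma>"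
    using 8(4) by (elim length_append_singleton_cases) auto
  have IH: "z \<in> fv (F E p xs j) \<Longrightarrow> length xs = Suc (Suc (length \<Gamma>)) \<Longrightarrow>
      j < Suc (Suc (length \<Gamma>)) \<Longrightarrow> z \<in> vars p - eigs p \<union> fvs xs" for z xs j
    using 8(2)[of xs j] 8(3) by auto
  have "fvf A \<subseteq> vars p - eigs p"
    using fvf_proof[OF 8(1), of A] 8(3) by simp
  then have W: "z \<in> fvp (W A a b) \<Longrightarrow> z \<in> vars p - eigs p \<union> fv a \<union> fv b" for z a b
    using fvp_W[of A a b] by auto
  show ?case
    using 8(5) ws by (auto simp: Let_def nth_append dest!: IH W)
next
  case (9 p \<Gamma> A)
  obtain us v where ws: "ws = us @ [v]" "length us = length \<Gamma>"
    using 9(5) by (elim length_append_singleton_cases) auto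
  have IH: "z \<in> fv (F E p us j) \<Longrightarrow> j < length \<Gamma> \<Longrightarrow> z \<in> vars p - eigs p \<union> fvs us" for z j
    using 9(3)[of us j] 9(4) ws by auto
  show ?case
    using 9(2,4,6) ws by (auto simp: Let_def nth_append fv_E dest!: IH)
next
  case (10 p \<Gamma> A)
  obtain us v where ws: "ws = us @ [v]" "length us = length \<Gamma>"
    using 10(4) by (elim length_append_singleton_cases) auto
  have IH: "z \<in> fv (F E p xs j) \<Longrightarrow> length xs = Suc (length \<Gamma>) \<Longrightarrow> j < Suc (length \<Gamma>) \<Longrightarrow>
      z \<in> vars p - eigs p \<union> fvs xs" for z xs j
    using 10(2)[of xs j] 10(3) by auto
  show ?case
    using 10(5) ws by (auto simp: Let_def nth_append dest!: IH)
next
  case (11 p \<Gamma> A q \<Delta>)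
  obtain us vs where ws: "ws = us @ vs" "length us = length \<Gamma>" "length vs = length \<Delta>"
    using 11(6) by (elim length_append_cases) auto
  have IHp: "z \<in> fv (F E p xs j) \<Longrightarrow> length xs = Suc (length \<Gamma>) \<Longrightarrow> j < Suc (length \<Gamma>) \<Longrightarrow>
      z \<in> vars p - eigs p - eigs q \<union> fvs xs" for z xs j
    using 11(3)[of xs j] 11(5) by auto
  have IHq: "z \<in> fv (F E q xs j) \<Longrightarrow> length xs = Suc (length \<Delta>) \<Longrightarrow> j < Suc (length \<Delta>) \<Longrightarrow>
      z \<in> vars q - eigs p - eigs q \<union> fvs xs" for z xs j
    using 11(4)[of xs j] 11(5) by auto
  show ?case
    using 11(7) ws by (auto simp: Let_def nth_append dest!: IHp IHq)
qed

text \<open>Well-typedness of the transformer is an assumption here because the lemma is applied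
  inside the induction of \<open>wt_F\<close>, to its induction hypothesis.\<close>

lemma wt_Abs_F:
  assumes "\<And>e ws i. wts L e ws (\<Gamma> @ [A]) \<Longrightarrow> i < length (\<Gamma> @ [A]) \<Longrightarrow> wt L e (F E p ws i) (pos ((\<Gamma> @ [A]) ! i))"
    and "wts L e us \<Gamma>" "length us = length \<Gamma>"
  shows "wt L e (Abs (neg A) (F E p) us (Bnd 0) (length \<Gamma>)) (neg A \<rightarrow>\<^sub>t pos A)"
proof -
  have "wts L (neg A # e) (map (lift 0) us @ [Bnd 0]) (\<Gamma> @ [A])"
    using assms(2) by (intro wts_append_singleton wts_lift wt_Bnd') auto
  from assms(1)[OF this, of "length \<Gamma>"] show ?thesis
    by (intro wt_Abs) simp
qed

lemma wt_F:
  "proof_of L p S \<Longrightarrow> wts L e ws S \<Longrightarrow> i < length S \<Longrightarrow> wt L e (F E p ws i) (pos (S ! i))"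
proof (induction arbitrary: e ws i rule: proof_of.induct)
  case (1 A)
  then show ?case
    by (auto simp: Let_def list_all2_Cons2 less_Suc_eq intro!: wt_Lam wt_lift intro: wt_App)
next
  case (2 p S \<pi>)
  have "wts L e (permute_list (inv \<pi>) ws) S"
    using 2(2,4) by (rule wts_permute_inv)
  then show ?case
    using 2 by (auto simp: permute_list_nth permutes_less)
next
  case (3 p \<Gamma> A B)
  from 3(4) obtain us v where ws: "ws = us @ [v]" "length us = length \<Gamma>" "wts L e us \<Gamma>"
    "wt L e v (neg (FOr A B))" by (rule wts_append_singleton_cases)
  define q where "q = Pr (Abs (neg A) (F E p) us (Bnd 0) (length \<Gamma>)) (Lam (neg B) (E B))"
  have q: "wt L e q (neg (FNeg A) \<otimes> neg (FNeg B))"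
    using wt_Abs_F[OF 3(3)] wt_E[OF 3(2)] ws unfolding q_def by (auto intro!: wt_intros)
  with ws(4) have "wt L e (Pi1 v \<bullet> Pi1 q \<bullet> Pi1 q) (neg A)"
    by (auto intro!: wt_intros)
  then have "wts L e (us @ [Pi1 v \<bullet> Pi1 q \<bullet> Pi1 q]) (\<Gamma> @ [A])"
    using ws by (auto intro: wts_append_singleton)
  from 3(3)[OF this, of i] show ?case
    using 3(5) ws q by (auto simp: Let_def nth_append q_def[symmetric])
next
  case (4 p \<Gamma> B A)
  from 4(4) obtain us v where ws: "ws = us @ [v]" "length us = length \<Gamma>" "wts L e us \<Gamma>"
    "wt L e v (neg (FOr A B))" by (rule wts_append_singleton_cases)
  define q where "q = Pr (Lam (neg A) (E A)) (Abs (neg B) (F E p) us (Bnd 0) (length \<Gamma>))"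
  have q: "wt L e q (neg (FNeg A) \<otimes> neg (FNeg B))"
    using wt_Abs_F[OF 4(3)] wt_E[OF 4(2)] ws unfolding q_def by (auto intro!: wt_intros)
  with ws(4) have "wt L e (Pi2 v \<bullet> Pi2 q \<bullet> Pi2 q) (neg B)"
    by (auto intro!: wt_intros)
  then have "wts L e (us @ [Pi2 v \<bullet> Pi2 q \<bullet> Pi2 q]) (\<Gamma> @ [B])"
    using ws by (auto intro: wts_append_singleton)
  from 4(3)[OF this, of i] show ?case
    using 4(5) ws q by (auto simp: Let_def nth_append q_def[symmetric])
next
  case (5 p \<Gamma> A p' \<Delta> B)
  from 5(5) obtain us vs w where ws: "ws = us @ vs @ [w]" "length us = length \<Gamma>"
    "length vs = length \<Delta>" "wts L e us \<Gamma>" "wts L e vs \<Delta>" "wt L e w (neg (FNeg (FOr A B)))"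
    by (elim wts_append_cases wts_append_singleton_cases) auto
  define q1 where "q1 = Abs (neg (FNeg A)) (F E p) us (Bnd 0) (length \<Gamma>)"
  define q2 where "q2 = Abs (neg (FNeg B)) (F E p') vs (Bnd 0) (length \<Delta>)"
  define q where "q = Lam (neg (FNeg (FOr A B))) (lift 0 (Pr q1 q2))"
  have "wt L e (Pr q1 q2) (neg (FOr A B))"
    using wt_Abs_F[OF 5(3)] wt_Abs_F[OF 5(4)] ws unfolding q1_def q2_def by (auto intro!: wt_intros)
  then have q: "wt L e q (pos (FNeg (FOr A B)))"
    unfolding q_def pos.simps neg.simps by (intro wt_Lam wt_lift) simp
  with ws(6) have w: "wt L e (w \<bullet> (q \<bullet> w)) (pos (FOr A B))"
    by (auto intro!: wt_intros)
  then have "wt L e (Pi1 (w \<bullet> (q \<bullet> w))) (neg (FNeg A))" "wt L e (Pi2 (w \<bullet> (q \<bullet> w))) (neg (FNeg B))"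
    by (auto intro: wt_intros)
  then have "wts L e (us @ [Pi1 (w \<bullet> (q \<bullet> w))]) (\<Gamma> @ [FNeg A])"
    "wts L e (vs @ [Pi2 (w \<bullet> (q \<bullet> w))]) (\<Delta> @ [FNeg B])"
    using ws by (auto intro!: wts_append_singleton)
  from 5(3)[OF this(1), of i] 5(4)[OF this(2), of "i - length \<Gamma>"] show ?case
    using 5(6) ws(2,3) q
    unfolding ws(1) F_NegOr[OF ws(2,3) q1_def q2_def q_def] by (auto simp: nth_append less_Suc_eq)
next
  case (6 p \<Gamma> t A)
  from 6(5) obtain us v where ws: "ws = us @ [v]" "length us = length \<Gamma>" "wts L e us \<Gamma>"
    "wt L e v (neg (FEx A))" by (rule wts_append_singleton_cases)
  define h where "h = Abs (neg A) (F E p) us (Bnd 0) (length \<Gamma>)"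
  have h: "wt L e h (neg (FNeg A))"
    using wt_Abs_F[OF 6(4)] ws unfolding h_def by simp
  moreover have t: "wt L e (Pr t h) (pos (FEx A))"
    using h wt_lterm[OF 6(2)] by (auto intro!: wt_intros)
  ultimately have "wt L e (v \<bullet> Pr t h \<bullet> h) (neg A)"
    using ws(4) by (auto intro!: wt_App)
  then have "wts L e (us @ [v \<bullet> Pr t h \<bullet> h]) (\<Gamma> @ [instf 0 t A])"
    using ws by (auto intro!: wts_append_singleton)
  from 6(4)[OF this, of i] show ?case
    using 6(6) ws t by (auto simp: Let_def nth_append h_def[symmetric])
next
  case (7 p \<Gamma> \<alpha> A)
  from 7(5) obtain us v where ws: "ws = us @ [v]" "length us = length \<Gamma>" "wts L e us \<Gamma>"
    "wt L e v (neg (FNeg (FEx A)))" by (rule wts_append_singleton_cases)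
  define h where "h = Abs (pos (FEx A)) (\<lambda>xs j. subst \<alpha> Iota (Pi1 (Bnd 0)) (F E p xs j))
    us (Pi2 (Bnd 0)) (length \<Gamma>)"
  \<comment> \<open>The bound variable of \<open>h\<close> stands for a pair: its first component
    replaces the eigenvariable, its second is the argument for the premise.\<close>
  have x: "wt L (pos (FEx A) # e) (Bnd 0) (Iota \<otimes> (neg A \<rightarrow>\<^sub>t pos A))"
    by (auto intro: wt_Bnd')
  have "wts L (pos (FEx A) # e) (map (lift 0) us @ [Pi2 (Bnd 0)]) (\<Gamma> @ [FNeg (instf 0 (Fv \<alpha> Iota) A)])"
    using ws wt_Pi2[OF x] by (intro wts_append_singleton wts_lift) auto
  from 7(4)[OF this, of "length \<Gamma>"] have h: "wt L e h (neg (FEx A))"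
    using wt_Pi1[OF x] unfolding h_def by (auto intro!: wt_Abs wt_subst)
  with ws(4) have vh: "wt L e (v \<bullet> h) (pos (FEx A))"
    by (auto intro: wt_intros)
  then have "wt L e (Pi1 (v \<bullet> h)) Iota"
    by (auto intro: wt_intros)
  moreover have "wts L e (us @ [Pi2 (v \<bullet> h)]) (\<Gamma> @ [FNeg (instf 0 (Fv \<alpha> Iota) A)])"
    using ws vh by (auto intro!: wts_append_singleton intro: wt_intros)
  note 7(4)[OF this, of i]
  moreover have "wt L e (Lam (neg (FNeg (FEx A))) (lift 0 h)) (pos (FNeg (FEx A)))"
    using h unfolding pos.simps neg.simps by (intro wt_Lam wt_lift) simp
  ultimately show ?case
    using 7(6) ws h by (auto simp: Let_def nth_append h_def[symmetric, simplified] wt_subst)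
next
  case (8 p \<Gamma> A)
  from 8(3) obtain us v where ws: "ws = us @ [v]" "length us = length \<Gamma>" "wts L e us \<Gamma>"
    "wt L e v (neg A)" by (rule wts_append_singleton_cases)
  have "wts L e (us @ [v, v]) (\<Gamma> @ [A, A])"
    using ws by (auto intro!: list_all2_appendI)
  note IH = 8(2)[OF this]
  have "wff L e A"
    using wff_proof[OF 8(1)] by (auto intro: wff_Nil)
  then show ?case
    using 8(4) ws IH[of i] IH[of "length \<Gamma>"] IH[of "length \<Gamma> + 1"]
    by (auto simp: Let_def nth_append intro!: wt_Case wf_W)
next
  case (9 p \<Gamma> A)
  from 9(4) obtain us v where ws: "ws = us @ [v]" "length us = length \<Gamma>" "wts L e us \<Gamma>"
    "wt L e v (neg A)" by (rule wts_append_singleton_cases)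
  from 9(3)[OF ws(3), of i] show ?case
    using 9(5) ws wt_E[OF 9(2)] by (auto simp: Let_def nth_append)
next
  case (10 p \<Gamma> A)
  from 10(3) obtain us v where ws: "ws = us @ [v]" "length us = length \<Gamma>" "wts L e us \<Gamma>"
    "wt L e v (neg (FNeg (FNeg A)))" by (rule wts_append_singleton_cases)
  define q where "q = Abs (neg A) (F E p) us (Bnd 0) (length \<Gamma>)"
  have q: "wt L e q (neg (FNeg A))"
    using wt_Abs_F[OF 10(2)] ws unfolding q_def by simp
  with ws(4) have "wt L e (v \<bullet> q \<bullet> q) (neg A)"
    by (auto intro!: wt_App)
  then have "wts L e (us @ [v \<bullet> q \<bullet> q]) (\<Gamma> @ [A])"
    using ws by (auto intro!: wts_append_singleton)
  note 10(2)[OF this, of i]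
  moreover have "wt L e (Lam (neg (FNeg (FNeg A))) (lift 0 q)) (pos (FNeg (FNeg A)))"
    using q unfolding pos.simps neg.simps by (intro wt_Lam wt_lift) simp
  ultimately show ?case
    using 10(4) ws by (auto simp: Let_def nth_append q_def[symmetric])
next
  case (11 p \<Gamma> A q \<Delta>)
  from 11(5) obtain us vs where ws: "ws = us @ vs" "length us = length \<Gamma>"
    "length vs = length \<Delta>" "wts L e us \<Gamma>" "wts L e vs \<Delta>"
    by (rule wts_append_cases)
  define h where "h = Abs (neg A) (F E p) us (Bnd 0) (length \<Gamma>)"
  have h: "wt L e h (neg (FNeg A))"
    using wt_Abs_F[OF 11(3)] ws unfolding h_def by simp
  then have vs: "wts L e (vs @ [h]) (\<Delta> @ [FNeg A])"
    using ws by (auto intro!: wts_append_singleton)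
  have "wt L e (F E q (vs @ [h]) (length \<Delta>)) (pos (FNeg A))"
    using 11(4)[OF vs, of "length \<Delta>"] by simp
  with h have "wt L e (F E q (vs @ [h]) (length \<Delta>) \<bullet> h) (neg A)"
    by (auto intro: wt_App)
  then have "wts L e (us @ [F E q (vs @ [h]) (length \<Delta>) \<bullet> h]) (\<Gamma> @ [A])"
    using ws by (auto intro!: wts_append_singleton)
  moreover have "i - length \<Gamma> < length \<Delta>" if "\<not> i < length \<Gamma>"
    using 11(6) that by auto
  ultimately show ?case
    using 11(3)[of e _ i] 11(4)[OF vs, of "i - length \<Gamma>"] 11(6) ws
    by (auto simp: Let_def nth_append h_def[symmetric])
qed

lemma inst_Abs_F:
  assumes "\<And>ws. length ws = Suc (length us) \<Longrightarrow>
      inst (Suc k) (lift 0 s) (F E p ws i) = F E p (map (inst (Suc k) (lift 0 s)) ws) i"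
  shows "inst k s (Abs U (F E p) us (Bnd 0) i) = Abs U (F E p) (map (inst k s) us) (Bnd 0) i"
  using assms by (intro inst_Abs) auto

lemma inst_Lam_lift: "inst k s (Lam U (lift 0 t)) = Lam U (lift 0 (inst k s t))"
  by (simp add: inst_Suc_lift)

text \<open>Transformers treat their arguments as opaque, and what they take from the proof itself
  (default terms, witnesses, formulas) has no loose indices. The obstruction is \<not>\<exists>,
  whose substitution for the eigenvariable also runs through the arguments; hence the condition on
  \<open>s\<close>. It survives the passage below a binder, where \<open>s\<close> becomes
  \<open>lift 0 s\<close> with the same free variables.\<close>

lemma inst_F:
  "proof_of L p S \<Longrightarrow> length ws = length S \<Longrightarrow> fv s \<inter> eigs p = {} \<Longrightarrow>
    inst k s (F E p ws i) = F E p (map (inst k s) ws) i"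
proof (induction arbitrary: ws k s i rule: proof_of.induct)
  case (1 A)
  then show ?case by (auto simp: Let_def length_Suc_conv inst_Suc_lift)
next
  case (2 p S \<pi>)
  then show ?case by (simp add: permute_list_map permutes_inv)
next
  case (3 p \<Gamma> A B)
  obtain us v where ws: "ws = us @ [v]" "length us = length \<Gamma>"
    using 3(4) by (elim length_append_singleton_cases) auto
  have IH: "inst k s (F E p xs j) = F E p (map (inst k s) xs) j"
    if "length xs = Suc (length \<Gamma>)" "fv s \<inter> eigs p = {}" for k xs s j
    using 3(3)[of xs s k j] that by simp
  show ?case
    using 3(5) ws by (simp add: Let_def nth_append IH inst_Abs_F inst_E[OF 3(2)])
next
  case (4 p \<Gamma> B A)
  obtain us v where ws: "ws = us @ [v]" "length us = length \<Gamma>"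
    using 4(4) by (elim length_append_singleton_cases) auto
  have IH: "inst k s (F E p xs j) = F E p (map (inst k s) xs) j"
    if "length xs = Suc (length \<Gamma>)" "fv s \<inter> eigs p = {}" for k xs s j
    using 4(3)[of xs s k j] that by simp
  show ?case
    using 4(5) ws by (simp add: Let_def nth_append IH inst_Abs_F inst_E[OF 4(2)])
next
  case (5 p \<Gamma> A q \<Delta> B)
  obtain us vs w where ws: "ws = us @ vs @ [w]" "length us = length \<Gamma>" "length vs = length \<Delta>"
    using 5(5) by (elim length_append_cases length_append_singleton_cases) auto
  have IHp: "inst k s (F E p xs j) = F E p (map (inst k s) xs) j"
    if "length xs = Suc (length \<Gamma>)" "fv s \<inter> eigs p = {}" for k xs s j
    using 5(3)[of xs s k j] that by simp
  have IHq: "inst k s (F E q xs j) = F E q (map (inst k s) xs) j"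
    if "length xs = Suc (length \<Delta>)" "fv s \<inter> eigs q = {}" for k xs s j
    using 5(4)[of xs s k j] that by simp
  have "fv s \<inter> eigs p = {}" "fv s \<inter> eigs q = {}"
    using 5(6) by auto
  then show ?case
    using ws by (simp add: Let_def nth_append IHp IHq inst_Abs_F inst_Lam_lift del: inst.simps(8) lift.simps)
next
  case (6 p \<Gamma> t A)
  obtain us v where ws: "ws = us @ [v]" "length us = length \<Gamma>"
    using 6(5) by (elim length_append_singleton_cases) auto
  have IH: "inst k s (F E p xs j) = F E p (map (inst k s) xs) j"
    if "length xs = Suc (length \<Gamma>)" "fv s \<inter> eigs p = {}" for k xs s j
    using 6(4)[of xs s k j] that by simp
  have "inst k s t = t"
    using inst_wt(1)[OF wt_lterm[OF 6(2)], of "[]"] by simp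
  then show ?case
    using 6(6) ws by (simp add: Let_def nth_append IH inst_Abs_F)
next
  case (7 p \<Gamma> \<alpha> A)
  obtain us v where ws: "ws = us @ [v]" "length us = length \<Gamma>"
    using 7(5) by (elim length_append_singleton_cases) auto
  have IH: "inst k s (F E p xs j) = F E p (map (inst k s) xs) j"
    if "length xs = Suc (length \<Gamma>)" "fv s \<inter> eigs p = {}" for k xs s j
    using 7(4)[of xs s k j] that by simp
  have s: "fv s \<inter> eigs p = {}" "(\<alpha>, Iota) \<notin> fv s"
    using 7(6) by auto
  have "inst k s (Abs U (\<lambda>xs j. subst \<alpha> Iota (Pi1 (Bnd 0)) (F E p xs j)) us (Pi2 (Bnd 0)) (length \<Gamma>)) =
      Abs U (\<lambda>xs j. subst \<alpha> Iota (Pi1 (Bnd 0)) (F E p xs j)) (map (inst k s) us) (Pi2 (Bnd 0)) (length \<Gamma>)"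
    for U
    using s ws(2) by (intro inst_Abs) (simp_all add: inst_subst IH)
  then show ?case
    using s ws by (simp add: Let_def nth_append IH inst_subst inst_Lam_lift del: inst.simps(8))
next
  case (8 p \<Gamma> A)
  obtain us v where ws: "ws = us @ [v]" "length us = length \<Gamma>"
    using 8(3) by (elim length_append_singleton_cases) auto
  have IH: "inst k s (F E p xs j) = F E p (map (inst k s) xs) j"
    if "length xs = Suc (Suc (length \<Gamma>))" for xs j
    using 8(2)[of xs s k j] 8(4) that by simp
  have "instf k s A = A"
    using wff_proof[OF 8(1), of A] by (simp add: instf_wff)
  then show ?case
    using ws by (simp add: Let_def nth_append IH instp_W)
next
  case (9 p \<Gamma> A)
  obtain us v where ws: "ws = us @ [v]" "length us = length \<Gamma>"
    using 9(4) by (elim length_append_singleton_cases) auto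
  show ?case
    using 9(3)[of us s k i] 9(5) ws by (simp add: Let_def nth_append inst_E[OF 9(2)])
next
  case (10 p \<Gamma> A)
  obtain us v where ws: "ws = us @ [v]" "length us = length \<Gamma>"
    using 10(3) by (elim length_append_singleton_cases) auto
  have IH: "inst k s (F E p xs j) = F E p (map (inst k s) xs) j"
    if "length xs = Suc (length \<Gamma>)" "fv s \<inter> eigs p = {}" for k xs s j
    using 10(2)[of xs s k j] that by simp
  show ?case
    using 10(4) ws by (simp add: Let_def nth_append IH inst_Abs_F inst_Lam_lift del: inst.simps(8))
next
  case (11 p \<Gamma> A q \<Delta>)
  obtain us vs where ws: "ws = us @ vs" "length us = length \<Gamma>" "length vs = length \<Delta>"
    using 11(5) by (elim length_append_cases) auto
  have IHp: "inst k s (F E p xs j) = F E p (map (inst k s) xs) j"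
    if "length xs = Suc (length \<Gamma>)" "fv s \<inter> eigs p = {}" for k xs s j
    using 11(3)[of xs s k j] that by simp
  have IHq: "inst k s (F E q xs j) = F E q (map (inst k s) xs) j"
    if "length xs = Suc (length \<Delta>)" "fv s \<inter> eigs q = {}" for k xs s j
    using 11(4)[of xs s k j] that by simp
  have "fv s \<inter> eigs p = {}" "fv s \<inter> eigs q = {}"
    using 11(6) by auto
  then show ?case
    using ws by (simp add: Let_def nth_append IHp IHq inst_Abs_F)
qed

text \<open>Describes the contractum when an abstracted transformer is applied to \<open>w\<close>:
  the lifted side arguments return to themselves and \<open>w\<close> lands in the abstracted
  one.\<close>

lemma inst_body_F:
  assumes "proof_of L p S" "length us + 1 = length S" "fv w \<inter> eigs p = {}"
  shows "inst 0 w (F E p (map (lift 0) us @ [x]) i) = F E p (us @ [inst 0 w x]) i"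
  using inst_F[OF assms(1), of "map (lift 0) us @ [x]" w 0 i] assms(2,3) by (simp add: comp_def)

end

section \<open>Derived rules of the calculus\<close>

lemma QF_weaken: "QF L \<Sigma> B \<Longrightarrow> \<Sigma> \<subseteq> \<Sigma>' \<Longrightarrow> QF L \<Sigma>' B"
proof (induction arbitrary: \<Sigma>' rule: QF.induct)
  case (QF_discharge A \<Sigma> B)
  have "QF L (insert A \<Sigma>') B"
    using QF_discharge.IH[of "insert A \<Sigma>'"] QF_discharge.prems by auto
  with QF_discharge.hyps(1) show ?case
    by (rule QF.QF_discharge)
next
  case (QF_mp \<Sigma> A B)
  from QF.QF_mp[OF QF_mp.IH(1,2)[OF QF_mp.prems]] show ?case .
next
  case (QF_subst \<Sigma> x U u B v)
  from QF.QF_subst[OF QF_subst.IH(1,2)[OF QF_subst.prems] QF_subst.hyps(3-5)] show ?case .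
qed (auto intro: QF_hyp QF_taut QF_conv QF_case_true QF_case_false)

lemma conv_wt: "conv L U u v \<Longrightarrow> wt L [] u U \<and> wt L [] v U"
  unfolding conv_def by (metis (no_types, lifting) rtranclp.cases)

inductive_cases wfprp_Or_cases: "wfprp L e (Or A B)"
inductive_cases wfprp_Neg_cases: "wfprp L e (Neg A)"
inductive_cases wfprp_Equ_cases: "wfprp L e (Equ u v)"

lemma wfprp_simps [simp]:
  "wfprp L e (Or A B) \<longleftrightarrow> wfprp L e A \<and> wfprp L e B"
  "wfprp L e (Neg A) \<longleftrightarrow> wfprp L e A"
  by (auto intro: wf_Or wf_Neg elim: wfprp_Or_cases wfprp_Neg_cases)

text \<open>Allows the well-formedness of the disjuncts of a premise to be read off its provability.
  The condition on \<Sigma> is there because \<open>QF_hyp\<close> accepts arbitrary raw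
  propositions.\<close>

lemma QF_wf: "QF L \<Sigma> B \<Longrightarrow> \<forall>A\<in>\<Sigma>. wfprp L [] A \<Longrightarrow> wfprp L [] B"
proof (induction rule: QF.induct)
  case (QF_conv U u v \<Sigma>)
  then show ?case by (auto intro: wf_Equ dest: conv_wt)
next
  case (QF_subst \<Sigma> x U u B v)
  then show ?case by (auto intro: wt_subst)
qed (auto intro: wt_intros)

lemma QF_ident: "wfprp L [] A \<Longrightarrow> QF L \<Sigma> (Imp A A)"
  using QF_taut[of "POr (PNeg (PVar 0)) (PVar 0)" L "\<lambda>_. A" \<Sigma>] by simp

lemma QF_orI1: "QF L \<Sigma> A \<Longrightarrow> wfprp L [] A \<Longrightarrow> wfprp L [] B \<Longrightarrow> QF L \<Sigma> (Or A B)"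
  by (rule QF_mp, assumption)
    (use QF_taut[of "POr (PNeg (PVar 0)) (POr (PVar 0) (PVar 1))" L "\<lambda>n. if n = 0 then A else B" \<Sigma>]
     in simp)

lemma QF_orI2: "QF L \<Sigma> B \<Longrightarrow> wfprp L [] A \<Longrightarrow> wfprp L [] B \<Longrightarrow> QF L \<Sigma> (Or A B)"
  by (rule QF_mp, assumption)
    (use QF_taut[of "POr (PNeg (PVar 1)) (POr (PVar 0) (PVar 1))" L "\<lambda>n. if n = 0 then A else B" \<Sigma>]
     in simp)

lemma QF_orE:
  assumes "QF L \<Sigma> (Or A B)" "QF L (insert A \<Sigma>) C" "QF L (insert B \<Sigma>) C"
    and "wfprp L [] A" "wfprp L [] B" "wfprp L [] C"
  shows "QF L \<Sigma> C"
proof -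
  let ?\<phi> = "POr (PNeg (POr (PVar 0) (PVar 1))) (POr (PNeg (POr (PNeg (PVar 0)) (PVar 2)))
    (POr (PNeg (POr (PNeg (PVar 1)) (PVar 2))) (PVar 2)))"
  have "QF L \<Sigma> (pinst (\<lambda>n. if n = 0 then A else if n = 1 then B else C) ?\<phi>)"
    using assms by (intro QF_taut) auto
  then have "QF L \<Sigma> (Imp (Or A B) (Imp (Imp A C) (Imp (Imp B C) C)))"
    by simp
  from QF_mp[OF QF_discharge[OF assms(5,3)] QF_mp[OF QF_discharge[OF assms(4,2)] QF_mp[OF assms(1) this]]]
  show ?thesis .
qed

lemma QF_negE: "QF L \<Sigma> A \<Longrightarrow> QF L \<Sigma> (Neg A) \<Longrightarrow> wfprp L [] A \<Longrightarrow> wfprp L [] C \<Longrightarrow> QF L \<Sigma> C"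
  by (rule QF_mp[of L \<Sigma> A C], assumption) (auto intro: QF_orI1)

text \<open>\<open>Imp A A\<close> abbreviates \<open>Or (Neg A) A\<close>, so the identity is
  already excluded middle.\<close>

lemma QF_cases:
  assumes "QF L (insert A \<Sigma>) C" "QF L (insert (Neg A) \<Sigma>) C" "wfprp L [] A" "wfprp L [] C"
  shows "QF L \<Sigma> C"
  by (rule QF_orE[of L \<Sigma> "Neg A" A]) (use assms QF_ident[of L A] in auto)

lemma QF_negI:
  "QF L (insert A \<Sigma>) B \<Longrightarrow> QF L (insert A \<Sigma>) (Neg B) \<Longrightarrow> wfprp L [] A \<Longrightarrow> wfprp L [] B \<Longrightarrow>
    QF L \<Sigma> (Neg A)"
  by (rule QF_cases[of L A]) (auto intro: QF_negE QF_hyp)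

lemma wfprp_Disj: "wfprp L [] (Disj Bs) \<longleftrightarrow> (\<forall>B\<in>set Bs. wfprp L [] B)"
  by (induction Bs rule: Disj.induct) (auto intro: wt_intros)

lemma QF_Disj_I:
  "B \<in> set Bs \<Longrightarrow> QF L \<Sigma> B \<Longrightarrow> \<forall>B\<in>set Bs. wfprp L [] B \<Longrightarrow> QF L \<Sigma> (Disj Bs)"
  by (induction Bs rule: Disj.induct) (auto intro: QF_orI1 QF_orI2 simp: wfprp_Disj)

lemma QF_refl: "wt L [] u U \<Longrightarrow> QF L \<Sigma> (Equ u u)"
  by (rule QF_conv[of L U]) (simp add: conv_def)

lemma QF_Disj_E:
  "QF L \<Sigma> (Disj Bs) \<Longrightarrow> (\<And>B. B \<in> set Bs \<Longrightarrow> QF L (insert B \<Sigma>) C) \<Longrightarrow>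
    \<forall>B\<in>set Bs. wfprp L [] B \<Longrightarrow> wfprp L [] C \<Longrightarrow> QF L \<Sigma> C"
proof (induction Bs arbitrary: \<Sigma> rule: Disj.induct)
  \<comment> \<open>The empty disjunction is the negation of \<open>Equ Eps Eps\<close>, which
    reflexivity refutes.\<close>
  case 1
  have "QF L \<Sigma> (Equ Eps Eps)"
    by (rule QF_refl[OF wt_Eps])
  with 1 show ?case by (auto intro: QF_negE wt_intros)
next
  case (2 B)
  from QF_mp[OF 2(1)[simplified] QF_discharge[of L B \<Sigma> C]] 2 show ?case by simp
next
  case (3 B B' Bs)
  show ?case
  proof (rule QF_orE[of L \<Sigma> B "Disj (B' # Bs)"])
    show "QF L \<Sigma> (Or B (Disj (B' # Bs)))" "QF L (insert B \<Sigma>) C" "wfprp L [] B" "wfprp L [] C"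
      "wfprp L [] (Disj (B' # Bs))"
      using 3(2-) by (auto simp: wfprp_Disj)
    show "QF L (insert (Disj (B' # Bs)) \<Sigma>) C"
    proof (rule 3(1))
      fix B'' assume "B'' \<in> set (B' # Bs)"
      then have "QF L (insert B'' \<Sigma>) C"
        using 3(3) by auto
      then show "QF L (insert B'' (insert (Disj (B' # Bs)) \<Sigma>)) C"
        by (rule QF_weaken) auto
    qed (use 3 in \<open>auto intro: QF_hyp\<close>)
  qed
qed

section \<open>Closure of conversion and provability under substitution\<close>

lemma red_subst:
  shows "red s t \<Longrightarrow> red (subst x U r s) (subst x U r t)"
    and "redp B C \<Longrightarrow> redp (substp x U r B) (substp x U r C)"
  by (induction arbitrary: r and r rule: red_redp.inducts)
    (auto simp: subst_inst intro: red_redp.intros)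

lemma conv_subst:
  assumes "conv L V u v" "wt L [] r U"
  shows "conv L V (subst x U r u) (subst x U r v)"
proof -
  let ?R = "\<lambda>s t. wt L [] s V \<and> wt L [] t V \<and> (red s t \<or> red t s)"
  have "?R\<^sup>*\<^sup>* (subst x U r u) (subst x U r v)" if "?R\<^sup>*\<^sup>* u v"
    using that
  proof induction
    case (step s t)
    then have "?R (subst x U r s) (subst x U r t)"
      using assms(2) by (auto intro: wt_subst red_subst)
    with step(3) show ?case by (rule rtranclp.rtrancl_into_rtrancl)
  qed simp
  with assms show ?thesis
    by (auto simp: conv_def intro: wt_subst)
qed

lemma substp_pinst: "substp x U r (pinst \<sigma> \<phi>) = pinst (\<lambda>n. substp x U r (\<sigma> n)) \<phi>"
  by (induction \<phi>) auto

text \<open>The variable that a substitution step replaces may occur in \<open>r\<close>; it is renamed first.\<close>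

lemma QF_substp: "QF L \<Sigma> B \<Longrightarrow> wt L [] r U \<Longrightarrow> QF L (substp x U r ` \<Sigma>) (substp x U r B)"
proof (induction rule: QF.induct)
  case (QF_taut \<phi> \<sigma> \<Sigma>)
  then have "wfprp L [] (pinst (\<lambda>n. substp x U r (\<sigma> n)) \<phi>)"
    by (auto simp flip: substp_pinst intro: wt_subst)
  with QF_taut show ?case by (simp add: substp_pinst QF.QF_taut)
next
  case (QF_conv V u v \<Sigma>)
  then show ?case by (auto intro: QF.QF_conv conv_subst)
next
  case (QF_mp \<Sigma> A B)
  from QF.QF_mp[OF QF_mp.IH(1,2)[OF QF_mp.prems, simplified]] show ?case by simp
next
  case (QF_subst \<Sigma> z V u B v)
  obtain y where y: "(y, V) \<notin> insert (x, U) (fvp B \<union> fv r)"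
    using ex_fresh[of "insert (x, U) (fvp B \<union> fv r)" V] by auto
  define B' where "B' = substp z V (Fv y V) B"
  have eq: "substp x U r (substp z V w B) = substp y V (subst x U r w) (substp x U r B')" for w
    using subst_rename(2)[of y V B w z] subst_subst(2)[of x U y V r w B'] y by (auto simp: B'_def)
  have "wfprp L [] (substp x U r B')"
    using QF_subst by (auto simp: B'_def intro!: wt_subst wt_Fv)
  moreover have "QF L (substp x U r ` \<Sigma>) (Equ (subst x U r u) (subst x U r v))"
    using QF_subst.IH(2)[OF QF_subst.prems] by simp
  ultimately show ?case
    unfolding eq using QF_subst.IH(1)[OF QF_subst.prems, unfolded eq] QF_subst.hyps(4,5) QF_subst.prems
    by (intro QF.QF_subst[of L _ y V "subst x U r u" _ "subst x U r v"]) (auto intro: wt_subst)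
next
  case (QF_discharge A \<Sigma> B)
  then show ?case by (auto intro: QF.QF_discharge wt_subst)
qed (auto intro: QF_hyp QF_case_true QF_case_false wt_subst)

text \<open>The hypotheses \<Sigma> are needed for contraction, where the \<open>case\<close> term
  equals one of its branches only under the condition or its negation. The typings are part of the
  notion because the substitution rule demands them.\<close>

definition eqt :: "('f, 'r) vocab \<Rightarrow> ('f, 'r) prp set \<Rightarrow> ty \<Rightarrow> ('f, 'r) trm \<Rightarrow> ('f, 'r) trm \<Rightarrow> bool" where
  "eqt L \<Sigma> U u v \<longleftrightarrow> wt L [] u U \<and> wt L [] v U \<and> QF L \<Sigma> (Equ u v)"

definition eqv :: "('f, 'r) vocab \<Rightarrow> ('f, 'r) prp set \<Rightarrow> ('f, 'r) prp \<Rightarrow> ('f, 'r) prp \<Rightarrow> bool" where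
  "eqv L \<Sigma> A B \<longleftrightarrow> wfprp L [] A \<and> wfprp L [] B \<and> QF L (insert A \<Sigma>) B \<and> QF L (insert B \<Sigma>) A"

lemma eqt_refl: "wt L [] u U \<Longrightarrow> eqt L \<Sigma> U u u"
  by (auto simp: eqt_def intro: QF_refl)

lemma eqt_weaken: "eqt L \<Sigma> U u v \<Longrightarrow> \<Sigma> \<subseteq> \<Sigma>' \<Longrightarrow> eqt L \<Sigma>' U u v"
  by (auto simp: eqt_def intro: QF_weaken)

lemma QF_eqt_subst:
  "eqt L \<Sigma> U u v \<Longrightarrow> wfprp L [] B \<Longrightarrow> QF L \<Sigma> (substp x U u B) \<Longrightarrow> QF L \<Sigma> (substp x U v B)"
  unfolding eqt_def by (blast intro: QF_subst)

lemma eqt_subst: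
  assumes "eqt L \<Sigma> U u v" "wt L [] c V"
  shows "eqt L \<Sigma> V (subst x U u c) (subst x U v c)"
proof -
  obtain y where y: "(y, U) \<notin> fv c \<union> fv u"
    using ex_fresh[of "fv c \<union> fv u" U] by auto
  have fresh: "(y, U) \<notin> fv (subst x U u c)"
    using y fv_subst(1)[of x U u c] by auto
  \<comment> \<open>The left side is frozen at \<open>u\<close> while the fresh \<open>y\<close>
    marks what is to be replaced on the right; at \<open>u\<close> the template is an instance of
    reflexivity.\<close>
  define B where "B = Equ (subst x U u c) (subst x U (Fv y U) c)"
  have uv: "wt L [] u U" "wt L [] v U"
    using assms by (auto simp: eqt_def)
  have B: "substp y U w B = Equ (subst x U u c) (subst x U w c)" for w
    using y fresh by (simp add: B_def subst_rename)
  have "wfprp L [] B"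
    using assms uv unfolding B_def by (auto intro!: wf_Equ wt_subst wt_Fv)
  from QF_eqt_subst[OF assms(1) this, of y] show ?thesis
    unfolding B using assms uv by (auto simp: eqt_def intro: wt_subst QF_refl)
qed

lemma eqt_sym: "eqt L \<Sigma> U u v \<Longrightarrow> eqt L \<Sigma> U v u"
proof -
  assume uv: "eqt L \<Sigma> U u v"
  obtain x where x: "(x, U) \<notin> fv u"
    using ex_fresh[of "fv u" U] by auto
  have "wfprp L [] (Equ (Fv x U) u)"
    using uv by (auto simp: eqt_def intro: wt_intros)
  from QF_eqt_subst[OF uv this, of x] x uv show ?thesis
    by (auto simp: eqt_def intro: QF_refl)
qed

lemma eqt_trans [trans]: "eqt L \<Sigma> U u v \<Longrightarrow> eqt L \<Sigma> U v w \<Longrightarrow> eqt L \<Sigma> U u w"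
proof -
  assume uv: "eqt L \<Sigma> U u v" and vw: "eqt L \<Sigma> U v w"
  obtain x where x: "(x, U) \<notin> fv u"
    using ex_fresh[of "fv u" U] by auto
  have "wfprp L [] (Equ u (Fv x U))"
    using uv by (auto simp: eqt_def intro: wt_intros)
  from QF_eqt_subst[OF vw this, of x] x uv vw show ?thesis
    by (auto simp: eqt_def)
qed

lemma eqt_App: "eqt L \<Sigma> (U \<rightarrow>\<^sub>t V) f g \<Longrightarrow> eqt L \<Sigma> U u v \<Longrightarrow> eqt L \<Sigma> V (f \<bullet> u) (g \<bullet> v)"
proof -
  assume fg: "eqt L \<Sigma> (U \<rightarrow>\<^sub>t V) f g" and uv: "eqt L \<Sigma> U u v"
  then have wt: "wt L [] f (U \<rightarrow>\<^sub>t V)" "wt L [] g (U \<rightarrow>\<^sub>t V)" "wt L [] u U"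
    by (auto simp: eqt_def)
  obtain x where x: "(x, U \<rightarrow>\<^sub>t V) \<notin> fv u"
    using ex_fresh[of "fv u"] by auto
  obtain y where y: "(y, U) \<notin> fv g"
    using ex_fresh[of "fv g"] by auto
  have "eqt L \<Sigma> V (f \<bullet> u) (g \<bullet> u)"
    using eqt_subst[OF fg, of "Fv x (U \<rightarrow>\<^sub>t V) \<bullet> u" V x] x wt by (auto intro: wt_intros)
  also have "eqt L \<Sigma> V (g \<bullet> u) (g \<bullet> v)"
    using eqt_subst[OF uv, of "g \<bullet> Fv y U" V y] y wt by (auto intro: wt_intros)
  finally show ?thesis .
qed

lemma eqt_Pi1: "eqt L \<Sigma> (U \<otimes> V) u v \<Longrightarrow> eqt L \<Sigma> U (Pi1 u) (Pi1 v)"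
  using eqt_subst[of L \<Sigma> "U \<otimes> V" u v "Pi1 (Fv 0 (U \<otimes> V))" U 0] by (auto intro: wt_intros)

lemma eqt_Pi2: "eqt L \<Sigma> (U \<otimes> V) u v \<Longrightarrow> eqt L \<Sigma> V (Pi2 u) (Pi2 v)"
  using eqt_subst[of L \<Sigma> "U \<otimes> V" u v "Pi2 (Fv 0 (U \<otimes> V))" V 0] by (auto intro: wt_intros)

lemma eqt_red: "red u v \<Longrightarrow> wt L [] u U \<Longrightarrow> wt L [] v U \<Longrightarrow> eqt L \<Sigma> U u v"
  by (auto simp: eqt_def conv_def intro!: QF_conv[of L U])

lemma eqt_beta:
  "wt L [U] t V \<Longrightarrow> wt L [] u U \<Longrightarrow> eqt L \<Sigma> V (Lam U t \<bullet> u) (inst 0 u t)"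
  by (auto intro!: eqt_red red_beta intro: wt_intros wt_inst)

text \<open>The axiom and the rules for \<not>\<or>, \<not>\<exists> and \<not>\<not> all answer for
  their negated principal formula with such a constant function.\<close>

lemma eqt_beta_const:
  "wt L [] t V \<Longrightarrow> wt L [] u U \<Longrightarrow> eqt L \<Sigma> V (Lam U (lift 0 t) \<bullet> u) t"
  using eqt_beta[OF wt_lift] by fastforce

lemma eqt_Pi1_Pr: "wt L [] u U \<Longrightarrow> wt L [] v V \<Longrightarrow> eqt L \<Sigma> U (Pi1 (Pr u v)) u"
  by (auto intro!: eqt_red red_Pi1 intro: wt_intros)

lemma eqt_Pi2_Pr: "wt L [] u U \<Longrightarrow> wt L [] v V \<Longrightarrow> eqt L \<Sigma> V (Pi2 (Pr u v)) v"
  by (auto intro!: eqt_red red_Pi2 intro: wt_intros)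

lemma eqv_sym: "eqv L \<Sigma> A B \<Longrightarrow> eqv L \<Sigma> B A"
  by (auto simp: eqv_def)

lemma eqv_D: "eqv L \<Sigma> A B \<Longrightarrow> QF L \<Sigma> A \<Longrightarrow> QF L \<Sigma> B"
  unfolding eqv_def by (blast intro: QF_mp QF_discharge)

lemma eqv_weaken: "eqv L \<Sigma> A B \<Longrightarrow> \<Sigma> \<subseteq> \<Sigma>' \<Longrightarrow> eqv L \<Sigma>' A B"
  unfolding eqv_def by (meson QF_weaken insert_mono)

lemma eqv_trans [trans]: "eqv L \<Sigma> A B \<Longrightarrow> eqv L \<Sigma> B C \<Longrightarrow> eqv L \<Sigma> A C"
proof -
  have "QF L (insert A \<Sigma>) C" if "QF L (insert A \<Sigma>) B" "eqv L \<Sigma> B C" for A B C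
    using eqv_D[OF eqv_weaken[OF that(2) subset_insertI] that(1)] .
  from this[of A B C] this[of C B A] show "eqv L \<Sigma> A B \<Longrightarrow> eqv L \<Sigma> B C \<Longrightarrow> eqv L \<Sigma> A C"
    using eqv_sym[of L \<Sigma> A B] eqv_sym[of L \<Sigma> B C] by (simp add: eqv_def)
qed

lemma eqv_Neg: "eqv L \<Sigma> A B \<Longrightarrow> eqv L \<Sigma> (Neg A) (Neg B)"
proof -
  have "QF L (insert (Neg A) \<Sigma>) (Neg B)" if "eqv L \<Sigma> A B" for A B
    using that by (intro QF_negI[of L B _ A])
      (auto simp: eqv_def insert_commute[of B] intro: QF_hyp QF_weaken)
  then show "eqv L \<Sigma> A B \<Longrightarrow> eqv L \<Sigma> (Neg A) (Neg B)"
    by (simp add: eqv_def)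
qed

lemma eqv_subst:
  assumes "eqt L \<Sigma> U u v" "wfprp L [] B"
  shows "eqv L \<Sigma> (substp x U u B) (substp x U v B)"
proof -
  have "QF L (insert (substp x U u B) \<Sigma>) (substp x U v B)" if "eqt L \<Sigma> U u v" for u v
    using eqt_weaken[OF that subset_insertI] assms(2) by (rule QF_eqt_subst) (simp add: QF_hyp)
  with assms eqt_sym[OF assms(1)] show ?thesis
    by (auto simp: eqv_def eqt_def intro: wt_subst)
qed

lemma eqv_W:
  assumes "wff L [] A" "eqt L \<Sigma> (pos A) u u'" "eqt L \<Sigma> (neg A) v v'"
  shows "eqv L \<Sigma> (W A u v) (W A u' v')"
proof -
  have wt: "wt L [] u (pos A)" "wt L [] u' (pos A)" "wt L [] v (neg A)"
    using assms by (auto simp: eqt_def)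
  obtain x where x: "(x, pos A) \<notin> fvf A \<union> fv v"
    using ex_fresh[of "fvf A \<union> fv v"] by auto
  obtain y where y: "(y, neg A) \<notin> fvf A \<union> fv u'"
    using ex_fresh[of "fvf A \<union> fv u'"] by auto
  have "eqv L \<Sigma> (W A u v) (W A u' v)"
    using eqv_subst[OF assms(2), of "W A (Fv x (pos A)) v" x] x wt wf_W[OF assms(1) wt_Fv wt(3)]
    by (simp add: substp_W)
  also have "eqv L \<Sigma> (W A u' v) (W A u' v')"
    using eqv_subst[OF assms(3), of "W A u' (Fv y (neg A))" y] y wt wf_W[OF assms(1) wt(2) wt_Fv]
    by (simp add: substp_W)
  finally show ?thesis .
qed

text \<open>For \<exists>, \<open>W\<close> plants \<open>Pi1 (Pr t h)\<close> in the formula while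
  the premise contains \<open>t\<close>. These are different formulas, so \<open>eqv_W\<close>
  cannot relate them.\<close>

lemma eqv_W_instf:
  assumes "wff L [Iota] A" "eqt L \<Sigma> Iota s t" "wt L [] u (pos A)" "wt L [] v (neg A)"
  shows "eqv L \<Sigma> (W (instf 0 s A) u v) (W (instf 0 t A) u v)"
proof -
  obtain x where x: "(x, Iota) \<notin> fvf A \<union> fv u \<union> fv v"
    using ex_fresh[of "fvf A \<union> fv u \<union> fv v"] by auto
  have "wfprp L [] (W (instf 0 (Fv x Iota) A) u v)"
    using assms by (auto intro!: wf_W wff_instf wt_Fv)
  from eqv_subst[OF assms(2) this, of x] show ?thesis
    using x by (simp add: substp_W substf_instf)
qed

section \<open>Soundness of the transformers\<close>

lemma eqv_hyp: "eqv L {} A B \<Longrightarrow> QF L {A} B"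
  by (simp add: eqv_def)

lemma QF_neg_or:
  assumes "wfprp L [] A" "wfprp L [] B" "QF L \<Sigma> (Neg A)" "QF L \<Sigma> (Neg B)"
  shows "QF L \<Sigma> (Neg (Or A B))"
proof -
  let ?\<phi> = "POr (PNeg (PNeg (PVar 0))) (POr (PNeg (PNeg (PVar 1))) (PNeg (POr (PVar 0) (PVar 1))))"
  have "QF L \<Sigma> (pinst (\<lambda>n. if n = 0 then A else B) ?\<phi>)"
    using assms by (intro QF_taut) auto
  then have "QF L \<Sigma> (Imp (Neg A) (Imp (Neg B) (Neg (Or A B))))"
    by simp
  from QF_mp[OF assms(4) QF_mp[OF assms(3) this]] show ?thesis .
qed

lemma QF_neg_neg: "QF L \<Sigma> A \<Longrightarrow> wfprp L [] A \<Longrightarrow> QF L \<Sigma> (Neg (Neg A))"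
  by (rule QF_mp, assumption)
    (use QF_taut[of "POr (PNeg (PVar 0)) (PNeg (PNeg (PVar 0)))" L "\<lambda>_. A" \<Sigma>] in simp)

lemma substp_Disj: "substp x U s (Disj Bs) = Disj (map (substp x U s) Bs)"
  by (induction Bs rule: Disj.induct) auto

context inhabited
begin

section \<open>Reasoning with the disjunction attached to a sequent\<close>

abbreviation disjunct where
  "disjunct p S ws i \<equiv> W (S ! i) (F E p ws i) (ws ! i)"

abbreviation disj where
  "disj p S ws \<equiv> Disj (map (disjunct p S ws) [0..<length S])"

lemma wf_disjunct:
  "proof_of L p S \<Longrightarrow> wts L [] ws S \<Longrightarrow> i < length S \<Longrightarrow> wfprp L [] (disjunct p S ws i)"
  using wt_F[of p S "[]" ws i] wff_proof[of L p S "S ! i"] list_all2_nthD2[of _ ws S i]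
  by (auto intro: wf_W)

lemma wf_disj: "proof_of L p S \<Longrightarrow> wts L [] ws S \<Longrightarrow> wfprp L [] (disj p S ws)"
  by (auto simp: wfprp_Disj wf_disjunct)

lemma disj_I:
  assumes "proof_of L p S" "wts L [] ws S" "i < length S" "QF L \<Sigma> (disjunct p S ws i)"
  shows "QF L \<Sigma> (disj p S ws)"
  using assms by (intro QF_Disj_I[of "disjunct p S ws i"]) (auto simp: wf_disjunct)

lemma disj_I_eq:
  assumes "proof_of L p S" "wts L [] ws S" "F E p ws i = t" "i < length S"
    and "QF L \<Sigma> (W (S ! i) t (ws ! i))"
  shows "QF L \<Sigma> (disj p S ws)"
  using assms by (intro disj_I[of p S ws i]) auto

lemma disj_E:
  assumes "QF L {} (Disj (map f [0..<n]))" "proof_of L p S" "wts L [] ws S"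
    and "\<And>i. i < n \<Longrightarrow> QF L {f i} (disj p S ws)"
  shows "QF L {} (disj p S ws)"
  using assms QF_wf[OF assms(1)] by (intro QF_Disj_E[OF assms(1)]) (auto simp: wfprp_Disj wf_disjunct)

lemma disj_E2:
  assumes "QF L {} (Disj (map f [0..<m]))" "QF L {} (Disj (map g [0..<n]))"
    and "proof_of L p S" "wts L [] ws S"
    and "\<And>i j. i < m \<Longrightarrow> j < n \<Longrightarrow> QF L {f i, g j} (disj p S ws)"
  shows "QF L {} (disj p S ws)"
proof (rule disj_E[OF assms(1,3,4)])
  fix i assume i: "i < m"
  have g: "QF L {f i} (Disj (map g [0..<n]))"
    by (rule QF_weaken[OF assms(2)]) simp
  show "QF L {f i} (disj p S ws)"
    using assms(5)[OF i] QF_wf[OF assms(2)]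
    by (intro QF_Disj_E[OF g]) (auto simp: wfprp_Disj wf_disjunct[OF assms(3,4)] insert_commute)
qed

text \<open>Common pattern of \<or>, \<exists>, \<not>\<exists> and \<not>\<not>, where one
  principal formula replaces another. The premise's terms are a general \<open>f\<close>, since for
  \<not>\<exists> they are the transformers after substitution for the eigenvariable.\<close>

lemma disj_unary:
  assumes prem: "QF L {} (Disj (map (\<lambda>i. W ((\<Gamma> @ [A']) ! i) (f i) ((us @ [v']) ! i)) [0..<length (\<Gamma> @ [A'])]))"
    and concl: "proof_of L p (\<Gamma> @ [A])" "wts L [] (us @ [v]) (\<Gamma> @ [A])"
    and len: "length us = length \<Gamma>"
    and F: "\<And>i. F E p (us @ [v]) i = (if i < length \<Gamma> then f i else r)"
    and main: "QF L {W A' (f (length \<Gamma>)) v'} (W A r v)"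
  shows "QF L {} (disj p (\<Gamma> @ [A]) (us @ [v]))"
proof (rule disj_E[OF prem concl])
  fix i assume i: "i < length (\<Gamma> @ [A'])"
  have "QF L {W ((\<Gamma> @ [A']) ! i) (f i) ((us @ [v']) ! i)} (disjunct p (\<Gamma> @ [A]) (us @ [v]) i)"
    using i main len by (cases "i = length \<Gamma>") (auto simp: F nth_append intro: QF_hyp)
  then show "QF L {W ((\<Gamma> @ [A']) ! i) (f i) ((us @ [v']) ! i)} (disj p (\<Gamma> @ [A]) (us @ [v]))"
    using i by (intro disj_I[OF concl, of i]) auto
qed

lemma wt_Abs_F_proof:
  assumes "proof_of L p (\<Gamma> @ [A])" "wts L e us \<Gamma>" "length us = length \<Gamma>"
  shows "wt L e (Abs (neg A) (F E p) us (Bnd 0) (length \<Gamma>)) (neg A \<rightarrow>\<^sub>t pos A)"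
  using wt_F[OF assms(1)] assms(2,3) by (rule wt_Abs_F)

lemma fv_Abs_F:
  assumes "proof_of L p (\<Gamma> @ [A])" "regular p" "length us = length \<Gamma>"
  shows "fv (Abs U (F E p) us (Bnd 0) (length \<Gamma>)) \<subseteq> vars p - eigs p \<union> fvs us"
  using fv_F[OF assms(1,2), of "map (lift 0) us @ [Bnd 0]" "length \<Gamma>"] assms(3) by simp

text \<open>The beta step behind every logical rule and the cut: the abstracted transformer, applied
  to the challenge that \<open>W\<close> computes, becomes the transformer run at that
  challenge.\<close>

lemma eqt_Abs_F:
  assumes "proof_of L p (\<Gamma> @ [A])" "wts L [] us \<Gamma>" "wt L [] w (neg A)" "fv w \<inter> eigs p = {}"
  shows "eqt L \<Sigma> (pos A) (Abs (neg A) (F E p) us (Bnd 0) (length \<Gamma>) \<bullet> w) (F E p (us @ [w]) (length \<Gamma>))"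
proof -
  have "wts L [neg A] (map (lift 0) us @ [Bnd 0]) (\<Gamma> @ [A])"
    using assms(2) by (intro wts_append_singleton wts_lift wt_Bnd') auto
  from wt_F[OF assms(1) this, of "length \<Gamma>"] eqt_beta[OF _ assms(3)]
    inst_body_F[OF assms(1) _ assms(4), of us "Bnd 0"] list_all2_lengthD[OF assms(2)]
  show ?thesis
    by (fastforce simp: Abs_def)
qed

text \<open>Since \<open>q \<bullet> u\<close> converts to \<open>v\<close>, both disjuncts speak
  about \<open>W A (u \<bullet> v) v\<close>, one of them negatively; excluded middle
  finishes.\<close>

lemma disj_Lem:
  assumes "wff L [] A" "wts L [] ws [FNeg A, A]"
  shows "QF L {} (disj (PLem A) [FNeg A, A] ws)"
proof -
  obtain u v where ws: "ws = [u, v]" and wt: "wt L [] u (neg A \<rightarrow>\<^sub>t pos A)" "wt L [] v (neg A)"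
    using assms(2) by (auto simp: list_all2_Cons2)
  have concl: "proof_of L (PLem A) [FNeg A, A]"
    using assms(1) by (rule proof_of.intros)
  define q where "q = Lam (neg (FNeg A)) (lift 0 v)"
  have q: "eqt L {} (neg A) (q \<bullet> u) v"
    using eqt_beta_const[OF wt(2), of u "neg (FNeg A)"] wt(1) by (simp add: q_def)
  have uv: "wt L [] (u \<bullet> v) (pos A)"
    using wt by (rule wt_App)
  have "eqv L {} (W A (u \<bullet> (q \<bullet> u)) (q \<bullet> u)) (W A (u \<bullet> v) v)"
    by (rule eqv_W[OF assms(1) eqt_App[OF eqt_refl[OF wt(1)] q] q])
  then have *: "eqv L {} (W (FNeg A) q u) (Neg (W A (u \<bullet> v) v))"
    by (simp add: eqv_Neg)
  have wf: "wfprp L [] (W A (u \<bullet> v) v)"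
    using assms(1) uv wt(2) by (rule wf_W)
  show ?thesis
  proof (rule QF_cases[OF _ _ wf wf_disj[OF concl assms(2)]])
    show "QF L {W A (u \<bullet> v) v} (disj (PLem A) [FNeg A, A] ws)"
      by (rule disj_I[OF concl assms(2), of 1]) (auto simp: ws Let_def intro: QF_hyp)
    show "QF L {Neg (W A (u \<bullet> v) v)} (disj (PLem A) [FNeg A, A] ws)"
      using eqv_hyp[OF eqv_sym[OF *]]
      by (intro disj_I[OF concl assms(2), of 0]) (auto simp: ws q_def Let_def)
  qed
qed

lemma disj_Perm:
  assumes "proof_of L p S" "\<pi> permutes {..<length S}" "wts L [] ws (permute_list \<pi> S)"
    and "QF L {} (disj p S (permute_list (inv \<pi>) ws))"
  shows "QF L {} (disj (PPerm \<pi> p) (permute_list \<pi> S) ws)"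
proof -
  have concl: "proof_of L (PPerm \<pi> p) (permute_list \<pi> S)"
    using assms by (intro proof_of.intros)
  have len: "length ws = length S"
    using list_all2_lengthD[OF assms(3)] by simp
  show ?thesis
  proof (rule disj_E[OF assms(4) concl assms(3)])
    fix j assume j: "j < length S"
    then have i: "inv \<pi> j < length S"
      using permutes_less[OF permutes_inv[OF assms(2)]] by simp
    have "disjunct (PPerm \<pi> p) (permute_list \<pi> S) ws (inv \<pi> j) = disjunct p S (permute_list (inv \<pi>) ws) j"
      using assms(2) i j len by (simp add: permute_list_nth permutes_inv permutes_inverses)
    then show "QF L {disjunct p S (permute_list (inv \<pi>) ws) j} (disj (PPerm \<pi> p) (permute_list \<pi> S) ws)"
      using i by (intro disj_I[OF concl assms(3), of "inv \<pi> j"]) (auto intro: QF_hyp)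
  qed
qed

text \<open>The transformers feed terms built from one premise into the other premise, and these need not
  be closed; it suffices that the arguments avoid the eigenvariables.\<close>

lemma sound:
  "proof_of L p S \<Longrightarrow> regular p \<Longrightarrow> wts L [] ws S \<Longrightarrow> fvs ws \<inter> eigs p = {} \<Longrightarrow>
    QF L {} (disj p S ws)"
proof (induction arbitrary: ws rule: proof_of.induct)
  case (1 A)
  then show ?case by (intro disj_Lem)
next
  case (2 p S \<pi>)
  have "wts L [] (permute_list (inv \<pi>) ws) S"
    using 2(2,5) by (rule wts_permute_inv)
  moreover have "set (permute_list (inv \<pi>) ws) = set ws"
    using 2(2) list_all2_lengthD[OF 2(5)] by (simp add: permutes_inv)
  ultimately show ?case
    using 2 by (intro disj_Perm) auto
next
  case (3 p \<Gamma> A B)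
  from 3(5) obtain us v where ws: "ws = us @ [v]" "length us = length \<Gamma>" "wts L [] us \<Gamma>"
    and v: "wt L [] v (neg (FOr A B))" by (rule wts_append_singleton_cases)
  have concl: "proof_of L (POr1 \<Gamma> A B p) (\<Gamma> @ [FOr A B])"
    using 3(1,2) by (rule proof_of.intros)
  define h where "h = Abs (neg A) (F E p) us (Bnd 0) (length \<Gamma>)"
  define q where "q = Pr h (Lam (neg B) (E B))"
  \<comment> \<open>The challenge that \<open>W (FOr A B) q v\<close> computes for its first
    component. The other component of \<open>q\<close> is a default that is only required to have
    the right type.\<close>
  define a where "a = Pi1 v \<bullet> Pi1 q \<bullet> Pi1 q"
  have F: "F E (POr1 \<Gamma> A B p) (us @ [v]) i = (if i < length \<Gamma> then F E p (us @ [a]) i else q)" for i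
    using ws(2) by (simp add: Let_def nth_append a_def q_def h_def)
  have h: "wt L [] h (neg A \<rightarrow>\<^sub>t pos A)"
    unfolding h_def using 3(1) ws(3,2) by (rule wt_Abs_F_proof)
  have EB: "wt L [] (Lam (neg B) (E B)) (neg B \<rightarrow>\<^sub>t pos B)"
    using wt_E[OF 3(2)] by (rule wt_Lam)
  have q: "wt L [] q (pos (FOr A B))"
    using h EB by (auto simp: q_def intro: wt_intros)
  have a: "wt L [] a (neg A)"
    using v q by (auto simp: a_def intro!: wt_intros)
  have "fv h \<subseteq> vars p - eigs p \<union> fvs us"
    unfolding h_def using 3(1,4) ws(2) by (intro fv_Abs_F) auto
  then have fv: "fvs (us @ [a]) \<inter> eigs p = {}"
    using 3(6) ws(1) fv_E[OF 3(2)] by (auto simp: a_def q_def)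
  have "eqt L {} (pos A) (Pi1 q \<bullet> a) (h \<bullet> a)"
    unfolding q_def by (rule eqt_App[OF eqt_Pi1_Pr[OF h EB] eqt_refl[OF a]])
  also have "eqt L {} (pos A) (h \<bullet> a) (F E p (us @ [a]) (length \<Gamma>))"
    unfolding h_def using fv by (intro eqt_Abs_F[OF 3(1) ws(3) a]) auto
  finally have "eqv L {} (W A (Pi1 q \<bullet> a) a) (W A (F E p (us @ [a]) (length \<Gamma>)) a)"
    using wff_proof[OF 3(1)] eqt_refl[OF a] by (intro eqv_W) auto
  note * = eqv_hyp[OF eqv_sym[OF this]]
  have "wfprp L [] (W (FOr A B) q v)"
    using wff_proof[OF concl, of "FOr A B"] q v by (intro wf_W) auto
  then have main: "QF L {W A (F E p (us @ [a]) (length \<Gamma>)) a} (W (FOr A B) q v)"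
    using * by (auto simp: Let_def a_def intro: QF_orI1)
  show ?case
    unfolding ws(1)
  proof (rule disj_unary[OF _ concl 3(5)[unfolded ws(1)] ws(2) F main])
    show "QF L {} (disj p (\<Gamma> @ [A]) (us @ [a]))"
      using 3(4) a ws fv by (intro 3(3) wts_append_singleton) auto
  qed
next
  case (4 p \<Gamma> B A)
  from 4(5) obtain us v where ws: "ws = us @ [v]" "length us = length \<Gamma>" "wts L [] us \<Gamma>"
    and v: "wt L [] v (neg (FOr A B))" by (rule wts_append_singleton_cases)
  have concl: "proof_of L (POr2 \<Gamma> A B p) (\<Gamma> @ [FOr A B])"
    using 4(1,2) by (rule proof_of.intros)
  define h where "h = Abs (neg B) (F E p) us (Bnd 0) (length \<Gamma>)"
  define q where "q = Pr (Lam (neg A) (E A)) h"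
  define b where "b = Pi2 v \<bullet> Pi2 q \<bullet> Pi2 q"
  have F: "F E (POr2 \<Gamma> A B p) (us @ [v]) i = (if i < length \<Gamma> then F E p (us @ [b]) i else q)" for i
    using ws(2) by (simp add: Let_def nth_append b_def q_def h_def)
  have h: "wt L [] h (neg B \<rightarrow>\<^sub>t pos B)"
    unfolding h_def using 4(1) ws(3,2) by (rule wt_Abs_F_proof)
  have EA: "wt L [] (Lam (neg A) (E A)) (neg A \<rightarrow>\<^sub>t pos A)"
    using wt_E[OF 4(2)] by (rule wt_Lam)
  have q: "wt L [] q (pos (FOr A B))"
    using h EA by (auto simp: q_def intro: wt_intros)
  have b: "wt L [] b (neg B)"
    using v q by (auto simp: b_def intro!: wt_intros)
  have "fv h \<subseteq> vars p - eigs p \<union> fvs us"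
    unfolding h_def using 4(1,4) ws(2) by (intro fv_Abs_F) auto
  then have fv: "fvs (us @ [b]) \<inter> eigs p = {}"
    using 4(6) ws(1) fv_E[OF 4(2)] by (auto simp: b_def q_def)
  have "eqt L {} (pos B) (Pi2 q \<bullet> b) (h \<bullet> b)"
    unfolding q_def by (rule eqt_App[OF eqt_Pi2_Pr[OF EA h] eqt_refl[OF b]])
  also have "eqt L {} (pos B) (h \<bullet> b) (F E p (us @ [b]) (length \<Gamma>))"
    unfolding h_def using fv by (intro eqt_Abs_F[OF 4(1) ws(3) b]) auto
  finally have "eqv L {} (W B (Pi2 q \<bullet> b) b) (W B (F E p (us @ [b]) (length \<Gamma>)) b)"
    using wff_proof[OF 4(1)] eqt_refl[OF b] by (intro eqv_W) auto
  note * = eqv_hyp[OF eqv_sym[OF this]]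
  have "wfprp L [] (W (FOr A B) q v)"
    using wff_proof[OF concl, of "FOr A B"] q v by (intro wf_W) auto
  then have main: "QF L {W B (F E p (us @ [b]) (length \<Gamma>)) b} (W (FOr A B) q v)"
    using * by (auto simp: Let_def b_def intro: QF_orI2)
  show ?case
    unfolding ws(1)
  proof (rule disj_unary[OF _ concl 4(5)[unfolded ws(1)] ws(2) F main])
    show "QF L {} (disj p (\<Gamma> @ [B]) (us @ [b]))"
      using 4(4) b ws fv by (intro 4(3) wts_append_singleton) auto
  qed
next
  case (5 p \<Gamma> A p' \<Delta> B)
  from 5(6) obtain us vs w where ws: "ws = us @ vs @ [w]" "length us = length \<Gamma>"
    "length vs = length \<Delta>" "wts L [] us \<Gamma>" "wts L [] vs \<Delta>"
    and w: "wt L [] w (neg (FNeg (FOr A B)))"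
    by (elim wts_append_cases wts_append_singleton_cases) auto
  have concl: "proof_of L (PNegOr \<Gamma> \<Delta> A B p p') (\<Gamma> @ \<Delta> @ [FNeg (FOr A B)])"
    using 5(1,2) by (rule proof_of.intros)
  have wff: "wff L [] A" "wff L [] B"
    using wff_proof[OF 5(1), of "FNeg A"] wff_proof[OF 5(2), of "FNeg B"] by auto
  define q1 where "q1 = Abs (neg (FNeg A)) (F E p) us (Bnd 0) (length \<Gamma>)"
  define q2 where "q2 = Abs (neg (FNeg B)) (F E p') vs (Bnd 0) (length \<Delta>)"
  define q where "q = Lam (neg (FNeg (FOr A B))) (lift 0 (Pr q1 q2))"
  \<comment> \<open>\<open>W (FNeg (FOr A B)) q w\<close> evaluates the disjunction at response
    \<open>z\<close> and challenge \<open>q \<bullet> w\<close>, which converts to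
    \<open>Pr q1 q2\<close>; the two components of \<open>z\<close> become the arguments of the
    premises.\<close>
  define z where "z = w \<bullet> (q \<bullet> w)"
  have F: "F E (PNegOr \<Gamma> \<Delta> A B p p') ws i =
    (if i < length \<Gamma> then F E p (us @ [Pi1 z]) i
     else if i < length \<Gamma> + length \<Delta> then F E p' (vs @ [Pi2 z]) (i - length \<Gamma>) else q)" for i
    unfolding ws(1) z_def by (rule F_NegOr[OF ws(2,3) q1_def q2_def q_def])
  have q12: "wt L [] q1 (neg (FNeg A) \<rightarrow>\<^sub>t pos (FNeg A))" "wt L [] q2 (neg (FNeg B) \<rightarrow>\<^sub>t pos (FNeg B))"
    unfolding q1_def q2_def
    by (rule wt_Abs_F_proof[OF 5(1) ws(4,2)]) (rule wt_Abs_F_proof[OF 5(2) ws(5,3)])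
  then have Pr: "wt L [] (Pr q1 q2) (neg (FOr A B))"
    by (auto intro: wt_intros)
  have qw: "eqt L {} (neg (FOr A B)) (q \<bullet> w) (Pr q1 q2)"
    unfolding q_def using Pr w by (rule eqt_beta_const)
  have z: "wt L [] z (pos (FOr A B))"
    unfolding z_def using w qw by (auto simp: eqt_def intro: wt_App)
  then have z12: "wt L [] (Pi1 z) (neg (FNeg A))" "wt L [] (Pi2 z) (neg (FNeg B))"
    by (auto intro: wt_intros)
  have fvq: "fv q1 \<subseteq> vars p - eigs p \<union> fvs us" "fv q2 \<subseteq> vars p' - eigs p' \<union> fvs vs"
    using fv_Abs_F[OF 5(1) _ ws(2)] fv_Abs_F[OF 5(2) _ ws(3)] 5(5) unfolding q1_def q2_def by auto
  have disj: "eigs p \<inter> vars p' = {}" "vars p \<inter> eigs p' = {}" "fvs ws \<inter> eigs p = {}"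
    "fvs ws \<inter> eigs p' = {}"
    using 5(5,7) by auto
  \<comment> \<open>\<open>z\<close> contains both \<open>q1\<close> and \<open>q2\<close> and is
    passed to both premises, so each premise receives variables of the other.\<close>
  have fv: "fv z \<inter> eigs p = {}" "fv z \<inter> eigs p' = {}"
    using fvq disj unfolding z_def q_def ws(1) by (simp_all, blast+)
  define r where "r = F E p (us @ [Pi1 z]) (length \<Gamma>)"
  define s where "s = F E p' (vs @ [Pi2 z]) (length \<Delta>)"
  \<comment> \<open>The challenges at which \<open>W\<close> evaluates A and B in the conclusion.
    They convert to \<open>r \<bullet> Pi1 z\<close> and \<open>s \<bullet> Pi2 z\<close>, the ones
    that arise when \<open>W\<close> unfolds the negated formulas of the premises.\<close>
  define a where "a = Pi1 (q \<bullet> w) \<bullet> Pi1 z \<bullet> Pi1 z"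
  define b where "b = Pi2 (q \<bullet> w) \<bullet> Pi2 z \<bullet> Pi2 z"
  have "eqt L {} (pos (FNeg A)) (q1 \<bullet> Pi1 z) r"
    unfolding q1_def r_def using fv z12 ws by (intro eqt_Abs_F[OF 5(1)]) auto
  moreover have "eqt L {} (neg (FNeg A) \<rightarrow>\<^sub>t pos (FNeg A)) (Pi1 (q \<bullet> w)) q1"
    using eqt_trans[OF eqt_Pi1[OF qw[unfolded neg.simps(2)]] eqt_Pi1_Pr[OF q12]] .
  ultimately have "eqt L {} (pos (FNeg A)) (Pi1 (q \<bullet> w) \<bullet> Pi1 z) r"
    using eqt_trans[OF eqt_App[OF _ eqt_refl[OF z12(1)]]] by blast
  then have a: "eqt L {} (neg A) a (r \<bullet> Pi1 z)"
    unfolding a_def using eqt_refl[OF z12(1)] by (intro eqt_App[of _ _ "neg (FNeg A)"]) auto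
  have "eqt L {} (pos (FNeg B)) (q2 \<bullet> Pi2 z) s"
    unfolding q2_def s_def using fv z12 ws by (intro eqt_Abs_F[OF 5(2)]) auto
  moreover have "eqt L {} (neg (FNeg B) \<rightarrow>\<^sub>t pos (FNeg B)) (Pi2 (q \<bullet> w)) q2"
    using eqt_trans[OF eqt_Pi2[OF qw[unfolded neg.simps(2)]] eqt_Pi2_Pr[OF q12]] .
  ultimately have "eqt L {} (pos (FNeg B)) (Pi2 (q \<bullet> w) \<bullet> Pi2 z) s"
    using eqt_trans[OF eqt_App[OF _ eqt_refl[OF z12(2)]]] by blast
  then have b: "eqt L {} (neg B) b (s \<bullet> Pi2 z)"
    unfolding b_def using eqt_refl[OF z12(2)] by (intro eqt_App[of _ _ "neg (FNeg B)"]) auto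
  have "eqv L {} (W A (Pi1 z \<bullet> a) a) (W A (Pi1 z \<bullet> (r \<bullet> Pi1 z)) (r \<bullet> Pi1 z))"
    "eqv L {} (W B (Pi2 z \<bullet> b) b) (W B (Pi2 z \<bullet> (s \<bullet> Pi2 z)) (s \<bullet> Pi2 z))"
    using a b z12 by (auto intro!: eqv_W wff eqt_App eqt_refl)
  then have *: "QF L {W (FNeg A) r (Pi1 z)} (Neg (W A (Pi1 z \<bullet> a) a))"
    "QF L {W (FNeg B) s (Pi2 z)} (Neg (W B (Pi2 z \<bullet> b) b))"
    and wf: "wfprp L [] (W A (Pi1 z \<bullet> a) a)" "wfprp L [] (W B (Pi2 z \<bullet> b) b)"
    by (auto intro!: eqv_hyp eqv_Neg intro: eqv_sym simp: eqv_def)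
  have "QF L {W (FNeg A) r (Pi1 z), W (FNeg B) s (Pi2 z)}
      (Neg (Or (W A (Pi1 z \<bullet> a) a) (W B (Pi2 z \<bullet> b) b)))"
    using * by (intro QF_neg_or wf) (auto intro: QF_weaken)
  then have main: "QF L {W (FNeg A) r (Pi1 z), W (FNeg B) s (Pi2 z)} (W (FNeg (FOr A B)) q w)"
    by (simp add: z_def[symmetric] a_def b_def Let_def)
  have IH: "QF L {} (disj p (\<Gamma> @ [FNeg A]) (us @ [Pi1 z]))"
    "QF L {} (disj p' (\<Delta> @ [FNeg B]) (vs @ [Pi2 z]))"
    using 5(3)[of "us @ [Pi1 z]"] 5(4)[of "vs @ [Pi2 z]"] 5(5) z12 ws fv disj
    by (auto simp: wts_append_singleton Int_Un_distrib2)
  show ?case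
  proof (rule disj_E2[OF IH concl 5(6)])
    fix i j assume ij: "i < length (\<Gamma> @ [FNeg A])" "j < length (\<Delta> @ [FNeg B])"
    let ?\<Sigma> = "{disjunct p (\<Gamma> @ [FNeg A]) (us @ [Pi1 z]) i, disjunct p' (\<Delta> @ [FNeg B]) (vs @ [Pi2 z]) j}"
    consider "i < length \<Gamma>" | "j < length \<Delta>" | "i = length \<Gamma>" "j = length \<Delta>"
      using ij by fastforce
    then show "QF L ?\<Sigma> (disj (PNegOr \<Gamma> \<Delta> A B p p') (\<Gamma> @ \<Delta> @ [FNeg (FOr A B)]) ws)"
    proof cases
      case 1
      then show ?thesis
        using ws(1,2) by (intro disj_I_eq[OF concl 5(6) F[of i]]) (auto simp: nth_append intro!: QF_hyp)
    next
      case 2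
      then show ?thesis
        using ws(1-3)
        by (intro disj_I_eq[OF concl 5(6) F[of "length \<Gamma> + j"]]) (auto simp: nth_append intro!: QF_hyp)
    next
      case 3
      have "?\<Sigma> = {W (FNeg A) r (Pi1 z), W (FNeg B) s (Pi2 z)}"
        using 3 ws(2,3) by (simp add: nth_append r_def s_def)
      then show ?thesis
        using main ws(1-3)
        by (intro disj_I_eq[OF concl 5(6) F[of "length \<Gamma> + length \<Delta>"]])
          (auto simp: nth_append simp del: W.simps)
    qed
  qed
next
  case (6 p \<Gamma> t A)
  from 6(6) obtain us v where ws: "ws = us @ [v]" "length us = length \<Gamma>" "wts L [] us \<Gamma>"
    and v: "wt L [] v (neg (FEx A))" by (rule wts_append_singleton_cases)
  have concl: "proof_of L (PEx \<Gamma> A t p) (\<Gamma> @ [FEx A])"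
    using 6(1-3) by (rule proof_of.intros)
  define h where "h = Abs (neg A) (F E p) us (Bnd 0) (length \<Gamma>)"
  \<comment> \<open>\<open>W (FEx A) (Pr t h) v\<close> computes this challenge up to the conversion
    of \<open>Pi2 (Pr t h)\<close> to \<open>h\<close>.\<close>
  define a where "a = v \<bullet> Pr t h \<bullet> h"
  have F: "F E (PEx \<Gamma> A t p) (us @ [v]) i = (if i < length \<Gamma> then F E p (us @ [a]) i else Pr t h)" for i
    using ws(2) by (simp add: Let_def nth_append a_def h_def)
  have t: "wt L [] t Iota"
    using 6(2) by (rule wt_lterm)
  have h: "wt L [] h (neg (FNeg A))"
    using wt_Abs_F_proof[OF 6(1) ws(3,2)] by (simp add: h_def)
  have th: "wt L [] (Pr t h) (pos (FEx A))"
    using t h by (auto intro: wt_intros)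
  have vth: "wt L [] (v \<bullet> Pr t h) (neg (FNeg A) \<rightarrow>\<^sub>t neg A)"
    using v th by (auto intro: wt_App)
  have a: "wt L [] a (neg A)"
    unfolding a_def using vth h by (rule wt_App)
  have "fv h \<subseteq> vars p - eigs p \<union> fvs us"
    unfolding h_def using 6(1,5) ws(2) by (intro fv_Abs_F) auto
  then have fv: "fvs (us @ [a]) \<inter> eigs p = {}"
    using 6(5,7) ws(1) by (auto simp: a_def disjoint_iff)
  have "eqt L {} (neg (FNeg A)) (Pi2 (Pr t h)) h"
    using t h by (rule eqt_Pi2_Pr)
  from eqt_App[OF eqt_refl[OF vth] this]
  have a': "eqt L {} (neg A) (v \<bullet> Pr t h \<bullet> Pi2 (Pr t h)) a"
    by (simp add: a_def)
  have "eqt L {} (pos A) (Pi2 (Pr t h) \<bullet> (v \<bullet> Pr t h \<bullet> Pi2 (Pr t h))) (h \<bullet> a)"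
    using eqt_Pi2_Pr[OF t h] a' by (auto intro: eqt_App)
  also have "eqt L {} (pos A) (h \<bullet> a) (F E p (us @ [a]) (length \<Gamma>))"
    using eqt_Abs_F[OF 6(1) ws(3), of a "{}"] a fv by (simp add: h_def Int_Un_distrib2)
  finally have "eqv L {} (W (FEx A) (Pr t h) v) (W (instf 0 (Pi1 (Pr t h)) A) (F E p (us @ [a]) (length \<Gamma>)) a)"
    using a' wff_instf[OF 6(3) wt_Pi1[OF th[unfolded pos.simps]]] by (auto intro: eqv_W)
  also have "eqv L {} \<dots> (W (instf 0 t A) (F E p (us @ [a]) (length \<Gamma>)) a)"
    using 6(3) eqt_Pi1_Pr[OF t h] wt_F[OF 6(1) wts_append_singleton[OF ws(3)], of a "length \<Gamma>"] a ws(2)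
    by (intro eqv_W_instf) auto
  finally have main: "QF L {W (instf 0 t A) (F E p (us @ [a]) (length \<Gamma>)) a} (W (FEx A) (Pr t h) v)"
    by (rule eqv_hyp[OF eqv_sym])
  show ?case
    unfolding ws(1)
  proof (rule disj_unary[OF _ concl 6(6)[unfolded ws(1)] ws(2) F main])
    show "QF L {} (disj p (\<Gamma> @ [instf 0 t A]) (us @ [a]))"
      using 6(5) a ws fv by (intro 6(4) wts_append_singleton) auto
  qed
next
  case (7 p \<Gamma> \<alpha> A)
  from 7(6) obtain us v where ws: "ws = us @ [v]" "length us = length \<Gamma>" "wts L [] us \<Gamma>"
    and v: "wt L [] v (neg (FNeg (FEx A)))" by (rule wts_append_singleton_cases)
  have concl: "proof_of L (PNegEx \<Gamma> A \<alpha> p) (\<Gamma> @ [FNeg (FEx A)])"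
    using 7(1-3) by (rule proof_of.intros)
  let ?A = "instf 0 (Fv \<alpha> Iota) A"
  define h where "h = Abs (pos (FEx A)) (\<lambda>xs j. subst \<alpha> Iota (Pi1 (Bnd 0)) (F E p xs j))
    us (Pi2 (Bnd 0)) (length \<Gamma>)"
  define r where "r = Lam (neg (FNeg (FEx A))) (lift 0 h)"
  \<comment> \<open>As \<open>r \<bullet> v\<close> converts to \<open>h\<close>, the conclusion
    evaluates the existential formula at the response \<open>v \<bullet> h\<close>. Its first
    component is the witness chosen for the eigenvariable, its second the argument for the
    premise.\<close>
  define s where "s = Pi1 (v \<bullet> h)"
  define a where "a = Pi2 (v \<bullet> h)"
  define f where "f = (\<lambda>i. subst \<alpha> Iota s (F E p (us @ [a]) i))"
  have F: "F E (PNegEx \<Gamma> A \<alpha> p) (us @ [v]) i = (if i < length \<Gamma> then f i else r)" for i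
    using ws(2) unfolding r_def f_def a_def s_def h_def by (simp add: Let_def nth_append)
  have x: "wt L [pos (FEx A)] (Bnd 0) (Iota \<otimes> neg (FNeg A))"
    by (rule wt_Bnd') simp_all
  have "wts L [pos (FEx A)] (map (lift 0) us @ [Pi2 (Bnd 0)]) (\<Gamma> @ [FNeg ?A])"
    using ws(3) wt_Pi2[OF x] by (intro wts_append_singleton wts_lift) auto
  from wt_F[OF 7(1) this, of "length \<Gamma>"]
  have body: "wt L [pos (FEx A)] (subst \<alpha> Iota (Pi1 (Bnd 0))
      (F E p (map (lift 0) us @ [Pi2 (Bnd 0)]) (length \<Gamma>))) (pos (FNeg A))"
    using wt_Pi1[OF x] by (auto intro: wt_subst)
  then have h: "wt L [] h (neg (FEx A))"
    unfolding h_def neg.simps(4) by (rule wt_Abs)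
  have vh: "wt L [] (v \<bullet> h) (pos (FEx A))"
    using v h by (auto intro: wt_App)
  have s: "wt L [] s Iota" and a: "wt L [] a (neg (FNeg A))"
    using vh by (auto simp: s_def a_def intro: wt_intros)
  have fresh: "(\<alpha>, Iota) \<notin> fvs ws" "fvs ws \<inter> eigs p = {}"
    using 7(7) by auto
  have "fv (F E p (map (lift 0) us @ [Pi2 (Bnd 0)]) (length \<Gamma>)) \<subseteq> vars p - eigs p \<union> fvs us"
    using fv_F[OF 7(1), of "map (lift 0) us @ [Pi2 (Bnd 0)]" "length \<Gamma>"] 7(5) ws(2) by simp
  then have "fv h \<subseteq> vars p - eigs p \<union> fvs us - {(\<alpha>, Iota)}"
    unfolding h_def fv_Abs using fv_subst(1)[of \<alpha> Iota "Pi1 (Bnd 0)"] by fastforce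
  \<comment> \<open>Avoiding the other eigenvariables makes the induction hypothesis applicable at
    \<open>a\<close>; avoiding \<alpha>, which \<open>h\<close> has replaced by its bound variable,
    lets the instantiation of \<alpha> by \<open>s\<close> leave \<open>a\<close> alone.\<close>
  then have fv: "(\<alpha>, Iota) \<notin> fv (v \<bullet> h)" "fv (v \<bullet> h) \<inter> eigs p = {}"
    using fresh unfolding ws(1) by auto
  have IH: "QF L {} (disj p (\<Gamma> @ [FNeg ?A]) (us @ [a]))"
    using 7(5) a ws fv fresh(2)
    by (intro 7(4) wts_append_singleton) (auto simp: a_def Int_Un_distrib2)
  \<comment> \<open>The eigenvariable condition protects the side formulas and \<open>fresh\<close>
    their arguments, so instantiating the premise changes only its terms and its principal
    formula.\<close>
  have "substp \<alpha> Iota s (disjunct p (\<Gamma> @ [FNeg ?A]) (us @ [a]) i) =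
      W ((\<Gamma> @ [FNeg (instf 0 s A)]) ! i) (f i) ((us @ [a]) ! i)" if i: "i < length (\<Gamma> @ [FNeg ?A])" for i
  proof (cases "i < length \<Gamma>")
    case True
    then have "(\<alpha>, Iota) \<notin> fvf (\<Gamma> ! i)" "(\<alpha>, Iota) \<notin> fv (us ! i)"
      using 7(3) fresh(1) ws(1,2) by auto
    then show ?thesis
      using True ws(2) by (simp add: substp_W nth_append f_def)
  next
    case False
    then have "i = length \<Gamma>"
      using i by simp
    then show ?thesis
      using fv(1) 7(3) ws(2)
      by (simp add: substp_W substf_instf nth_append f_def a_def del: W.simps)
  qed
  then have "substp \<alpha> Iota s (disj p (\<Gamma> @ [FNeg ?A]) (us @ [a])) =
      Disj (map (\<lambda>i. W ((\<Gamma> @ [FNeg (instf 0 s A)]) ! i) (f i) ((us @ [a]) ! i))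
        [0..<length (\<Gamma> @ [FNeg (instf 0 s A)])])"
    unfolding substp_Disj map_map by (intro arg_cong[of _ _ Disj] map_cong) auto
  with QF_substp[OF IH s, of \<alpha>]
  have prem: "QF L {} (Disj (map (\<lambda>i. W ((\<Gamma> @ [FNeg (instf 0 s A)]) ! i) (f i) ((us @ [a]) ! i))
        [0..<length (\<Gamma> @ [FNeg (instf 0 s A)])]))"
    by simp
  let ?r = "f (length \<Gamma>)"
  \<comment> \<open>Contracting \<open>h \<bullet> (v \<bullet> h)\<close> puts
    \<open>v \<bullet> h\<close> for the bound pair, whose projections are then \<open>s\<close> and
    \<open>a\<close>. The result is the premise's transformer at \<open>a\<close> with \<alpha>
    replaced by \<open>s\<close>.\<close>
  have "inst 0 (v \<bullet> h) (subst \<alpha> Iota (Pi1 (Bnd 0)) (F E p (map (lift 0) us @ [Pi2 (Bnd 0)]) (length \<Gamma>))) = ?r"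
    using fv ws(2) inst_body_F[OF 7(1), of us "v \<bullet> h" "Pi2 (Bnd 0)" "length \<Gamma>"]
    by (simp add: inst_subst f_def s_def a_def)
  with eqt_beta[OF body vh] have hvh: "eqt L {} (pos (FNeg A)) (h \<bullet> (v \<bullet> h)) ?r"
    by (metis Abs_def h_def)
  have rv: "eqt L {} (neg (FEx A)) (r \<bullet> v) h"
    unfolding r_def using h v by (rule eqt_beta_const)
  have vrv: "eqt L {} (pos (FEx A)) (v \<bullet> (r \<bullet> v)) (v \<bullet> h)"
    by (rule eqt_App[OF eqt_refl[OF v[unfolded neg.simps(3)]] rv])
  have "wff L [] (FEx A)"
    using 7(2) by simp
  from eqv_Neg[OF eqv_W[OF this vrv rv]]
  have "eqv L {} (W (FNeg (FEx A)) r v)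
      (Neg (W (instf 0 s A) (a \<bullet> (h \<bullet> (v \<bullet> h) \<bullet> a)) (h \<bullet> (v \<bullet> h) \<bullet> a)))"
    by (simp add: s_def a_def)
  also have "eqt L {} (neg A) (h \<bullet> (v \<bullet> h) \<bullet> a) (?r \<bullet> a)"
    using eqt_App[OF hvh[unfolded pos.simps] eqt_refl[OF a[unfolded neg.simps]]] by simp
  then have "eqv L {} (Neg (W (instf 0 s A) (a \<bullet> (h \<bullet> (v \<bullet> h) \<bullet> a)) (h \<bullet> (v \<bullet> h) \<bullet> a)))
      (W (FNeg (instf 0 s A)) ?r a)"
    using wff_instf[OF 7(2) s] eqt_App[OF eqt_refl[OF a[unfolded neg.simps]]]
    by (auto intro!: eqv_Neg eqv_W)
  finally have main: "QF L {W (FNeg (instf 0 s A)) ?r a} (W (FNeg (FEx A)) r v)"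
    by (rule eqv_hyp[OF eqv_sym])
  show ?case
    unfolding ws(1)
    by (rule disj_unary[OF prem concl 7(6)[unfolded ws(1)] ws(2) F main])
next
  case (8 p \<Gamma> A)
  from 8(4) obtain us v where ws: "ws = us @ [v]" "length us = length \<Gamma>" "wts L [] us \<Gamma>"
    and v: "wt L [] v (neg A)" by (rule wts_append_singleton_cases)
  have concl: "proof_of L (PContr \<Gamma> A p) (\<Gamma> @ [A])"
    using 8(1) by (rule proof_of.intros)
  have wff: "wff L [] A"
    using wff_proof[OF 8(1)] by simp
  define a where "a = F E p (us @ [v, v]) (length \<Gamma>)"
  define b where "b = F E p (us @ [v, v]) (length \<Gamma> + 1)"
  have F: "F E (PContr \<Gamma> A p) ws i =
      (if i < length \<Gamma> then F E p (us @ [v, v]) i else Case (W A a v) a b)" for i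
    using ws(1,2) by (simp add: Let_def nth_append a_def b_def)
  have prem: "wts L [] (us @ [v, v]) (\<Gamma> @ [A, A])"
    using ws(3) v by (auto intro: list_all2_appendI)
  have a: "wt L [] a (pos A)" and b: "wt L [] b (pos A)"
    using wt_F[OF 8(1) prem, of "length \<Gamma>"] wt_F[OF 8(1) prem, of "length \<Gamma> + 1"]
    by (simp_all add: a_def b_def nth_append)
  have Wa: "wfprp L [] (W A a v)" and Wb: "wfprp L [] (W A b v)"
    using wff a b v by (auto intro: wf_W)
  have Wc: "wfprp L [] (W A (Case (W A a v) a b) v)"
    using wff a b v Wa by (auto intro: wf_W wt_Case)
  \<comment> \<open>Stated for any \<Sigma> because it is used again in \<open>main_b\<close>, with
    a further hypothesis present.\<close>
  have main_a: "QF L \<Sigma> (W A (Case (W A a v) a b) v)" if "W A a v \<in> \<Sigma>" for \<Sigma>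
  proof -
    have "eqt L \<Sigma> (pos A) (Case (W A a v) a b) a"
      using Wa a b QF_mp[OF QF_hyp[OF that] QF_case_true[OF Wa a b]]
      by (auto simp: eqt_def intro: wt_Case)
    from eqv_W[OF wff this eqt_refl[OF v]] show ?thesis
      using eqv_D[OF eqv_sym] QF_hyp[OF that] by blast
  qed
  \<comment> \<open>If the condition \<open>W A a v\<close> holds, the first branch is correct
    whatever \<open>b\<close> does; otherwise the \<open>case\<close> term equals \<open>b\<close>,
    which is correct by hypothesis.\<close>
  have main_b: "QF L {W A b v} (W A (Case (W A a v) a b) v)"
  proof (rule QF_cases[OF _ _ Wa Wc])
    let ?\<Sigma> = "{Neg (W A a v), W A b v}"
    have "eqt L ?\<Sigma> (pos A) (Case (W A a v) a b) b"
      using Wa a b QF_mp[OF QF_hyp QF_case_false[OF Wa a b], of ?\<Sigma>]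
      by (auto simp: eqt_def intro: wt_Case)
    from eqv_W[OF wff this eqt_refl[OF v]] show "QF L ?\<Sigma> (W A (Case (W A a v) a b) v)"
      by (rule eqv_D[OF eqv_sym]) (simp add: QF_hyp)
  qed (simp add: main_a)
  have IH: "QF L {} (disj p (\<Gamma> @ [A, A]) (us @ [v, v]))"
    using 8(3,5) ws(1) by (intro 8(2) prem) auto
  show ?case
  proof (rule disj_E[OF IH concl 8(4)])
    fix i assume "i < length (\<Gamma> @ [A, A])"
    then consider "i < length \<Gamma>" | "i = length \<Gamma>" | "i = length \<Gamma> + 1"
      by fastforce
    then show "QF L {disjunct p (\<Gamma> @ [A, A]) (us @ [v, v]) i} (disj (PContr \<Gamma> A p) (\<Gamma> @ [A]) ws)"
    proof cases
      case 1
      then show ?thesis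
        using ws(1,2) by (intro disj_I_eq[OF concl 8(4) F[of i]]) (auto simp: nth_append intro!: QF_hyp)
    next
      case 2
      then show ?thesis
        using ws(1,2) main_a
        by (intro disj_I_eq[OF concl 8(4) F[of "length \<Gamma>"]]) (auto simp: nth_append a_def[symmetric])
    next
      case 3
      then have "disjunct p (\<Gamma> @ [A, A]) (us @ [v, v]) i = W A b v"
        using ws(2) by (simp add: nth_append b_def)
      with main_b show ?thesis
        using ws(1,2) by (intro disj_I_eq[OF concl 8(4) F[of "length \<Gamma>"]]) (auto simp: nth_append)
    qed
  qed
next
  case (9 p \<Gamma> A)
  from 9(5) obtain us v where ws: "ws = us @ [v]" "length us = length \<Gamma>" "wts L [] us \<Gamma>"
    by (rule wts_append_singleton_cases)
  have concl: "proof_of L (PWeak \<Gamma> A p) (\<Gamma> @ [A])"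
    using 9(1,2) by (rule proof_of.intros)
  have IH: "QF L {} (disj p \<Gamma> us)"
    using 9(4,6) ws by (intro 9(3)) auto
  show ?case
  proof (rule disj_E[OF IH concl 9(5)])
    fix i assume "i < length \<Gamma>"
    then show "QF L {disjunct p \<Gamma> us i} (disj (PWeak \<Gamma> A p) (\<Gamma> @ [A]) ws)"
      using ws(2) by (intro disj_I[OF concl 9(5), of i]) (auto simp: ws(1) nth_append intro!: QF_hyp)
  qed
next
  case (10 p \<Gamma> A)
  from 10(4) obtain us v where ws: "ws = us @ [v]" "length us = length \<Gamma>" "wts L [] us \<Gamma>"
    and v: "wt L [] v (neg (FNeg (FNeg A)))" by (rule wts_append_singleton_cases)
  have concl: "proof_of L (PNegNeg \<Gamma> A p) (\<Gamma> @ [FNeg (FNeg A)])"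
    using 10(1) by (rule proof_of.intros)
  have wff: "wff L [] A"
    using wff_proof[OF 10(1)] by simp
  define q where "q = Abs (neg A) (F E p) us (Bnd 0) (length \<Gamma>)"
  define r where "r = Lam (neg (FNeg (FNeg A))) (lift 0 q)"
  \<comment> \<open>Unfolding both negations evaluates A, up to conversion, at response
    \<open>q \<bullet> a\<close> and challenge \<open>a\<close>.\<close>
  define a where "a = v \<bullet> q \<bullet> q"
  have F: "F E (PNegNeg \<Gamma> A p) (us @ [v]) i = (if i < length \<Gamma> then F E p (us @ [a]) i else r)" for i
    using ws(2) by (simp add: Let_def nth_append a_def q_def r_def)
  have q: "wt L [] q (neg (FNeg A))"
    using wt_Abs_F_proof[OF 10(1) ws(3,2)] by (simp add: q_def)
  have vq: "wt L [] (v \<bullet> q) (pos (FNeg A))"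
    using v q by (auto intro: wt_App)
  have a: "wt L [] a (neg A)"
    using vq q by (auto simp: a_def intro: wt_App)
  have "fv q \<subseteq> vars p - eigs p \<union> fvs us"
    unfolding q_def using 10(1,3) ws(2) by (intro fv_Abs_F) auto
  then have fv: "fvs (us @ [a]) \<inter> eigs p = {}"
    using 10(5) ws(1) by (auto simp: a_def)
  have rv: "eqt L {} (neg (FNeg A)) (r \<bullet> v) q"
    unfolding r_def using q v by (rule eqt_beta_const)
  have "eqv L {} (W (FNeg A) (v \<bullet> (r \<bullet> v)) (r \<bullet> v)) (W (FNeg A) (v \<bullet> q) q)"
    using wff rv v by (auto intro!: eqv_W eqt_App[of _ _ "neg (FNeg A)"] eqt_refl simp del: W.simps)
  from eqv_Neg[OF this]
  have 1: "eqv L {} (W (FNeg (FNeg A)) r v) (Neg (Neg (W A (q \<bullet> a) a)))"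
    by (simp add: a_def)
  have "eqt L {} (pos A) (q \<bullet> a) (F E p (us @ [a]) (length \<Gamma>))"
    unfolding q_def using fv by (intro eqt_Abs_F[OF 10(1) ws(3) a]) auto
  from eqv_W[OF wff this eqt_refl[OF a]]
  have 2: "QF L {W A (F E p (us @ [a]) (length \<Gamma>)) a} (W A (q \<bullet> a) a)" "wfprp L [] (W A (q \<bullet> a) a)"
    by (auto simp: eqv_def)
  have main: "QF L {W A (F E p (us @ [a]) (length \<Gamma>)) a} (W (FNeg (FNeg A)) r v)"
    using eqv_D[OF eqv_weaken[OF eqv_sym[OF 1]] QF_neg_neg[OF 2]] by simp
  show ?case
    unfolding ws(1)
  proof (rule disj_unary[OF _ concl 10(4)[unfolded ws(1)] ws(2) F main])
    show "QF L {} (disj p (\<Gamma> @ [A]) (us @ [a]))"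
      using 10(3) a ws fv by (intro 10(2) wts_append_singleton) auto
  qed
next
  case (11 p \<Gamma> A q \<Delta>)
  from 11(6) obtain us vs where ws: "ws = us @ vs" "length us = length \<Gamma>"
    "length vs = length \<Delta>" "wts L [] us \<Gamma>" "wts L [] vs \<Delta>"
    by (rule wts_append_cases)
  have concl: "proof_of L (PCut \<Gamma> \<Delta> A p q) (\<Gamma> @ \<Delta>)"
    using 11(1,2) by (rule proof_of.intros)
  have wff: "wff L [] A"
    using wff_proof[OF 11(1)] by simp
  define h where "h = Abs (neg A) (F E p) us (Bnd 0) (length \<Gamma>)"
  define r where "r = F E q (vs @ [h]) (length \<Delta>)"
  \<comment> \<open>\<open>W (FNeg A) r h\<close> is by definition the negation of
    \<open>W A (h \<bullet> a) a\<close>, and \<open>h \<bullet> a\<close> contracts to the first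
    premise's response to \<open>a\<close>. So the two cut formulas contradict each other.\<close>
  define a where "a = r \<bullet> h"
  have F: "F E (PCut \<Gamma> \<Delta> A p q) ws i =
      (if i < length \<Gamma> then F E p (us @ [a]) i else F E q (vs @ [h]) (i - length \<Gamma>))" for i
    using ws(1-3) by (simp add: Let_def h_def a_def r_def)
  have h: "wt L [] h (neg (FNeg A))"
    using wt_Abs_F_proof[OF 11(1) ws(4,2)] by (simp add: h_def)
  have vs: "wts L [] (vs @ [h]) (\<Delta> @ [FNeg A])"
    using ws(5) h by (rule wts_append_singleton)
  have r: "wt L [] r (pos (FNeg A))"
    using wt_F[OF 11(2) vs, of "length \<Delta>"] by (simp add: r_def)
  have a: "wt L [] a (neg A)"
    using r h by (auto simp: a_def intro: wt_App)
  have us: "wts L [] (us @ [a]) (\<Gamma> @ [A])"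
    using ws(4) a by (rule wts_append_singleton)
  have fvh: "fv h \<subseteq> vars p - eigs p \<union> fvs us"
    unfolding h_def using 11(1,5) ws(2) by (intro fv_Abs_F) auto
  have fvr: "fv r \<subseteq> vars q - eigs q \<union> fvs (vs @ [h])"
    unfolding r_def using 11(2,5) ws(3) by (intro fv_F) auto
  have disj: "eigs p \<inter> vars q = {}" "vars p \<inter> eigs q = {}" "fvs ws \<inter> eigs p = {}"
    "fvs ws \<inter> eigs q = {}"
    using 11(5,7) by auto
  \<comment> \<open>Here variables cross over: \<open>a\<close> brings variables of \<open>q\<close>
    into the arguments of \<open>p\<close>, and \<open>h\<close> brings variables of
    \<open>p\<close> into those of \<open>q\<close>. Regularity excludes a clash.\<close>
  have fv: "fvs (us @ [a]) \<inter> eigs p = {}" "fvs (vs @ [h]) \<inter> eigs q = {}"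
    using fvh fvr disj unfolding a_def ws(1) by (simp_all, blast+)
  have "eqt L {} (pos A) (h \<bullet> a) (F E p (us @ [a]) (length \<Gamma>))"
    unfolding h_def using fv(1) by (intro eqt_Abs_F[OF 11(1) ws(4) a]) auto
  from eqv_W[OF wff this eqt_refl[OF a]]
  have main: "QF L {W A (F E p (us @ [a]) (length \<Gamma>)) a} (W A (h \<bullet> a) a)" "wfprp L [] (W A (h \<bullet> a) a)"
    by (auto simp: eqv_def)
  have IH: "QF L {} (disj p (\<Gamma> @ [A]) (us @ [a]))" "QF L {} (disj q (\<Delta> @ [FNeg A]) (vs @ [h]))"
    using 11(3)[OF _ us fv(1)] 11(4)[OF _ vs fv(2)] 11(5) by auto
  show ?case
  proof (rule disj_E2[OF IH concl 11(6)])
    fix i j assume ij: "i < length (\<Gamma> @ [A])" "j < length (\<Delta> @ [FNeg A])"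
    let ?\<Sigma> = "{disjunct p (\<Gamma> @ [A]) (us @ [a]) i, disjunct q (\<Delta> @ [FNeg A]) (vs @ [h]) j}"
    consider "i < length \<Gamma>" | "j < length \<Delta>" | "i = length \<Gamma>" "j = length \<Delta>"
      using ij by fastforce
    then show "QF L ?\<Sigma> (disj (PCut \<Gamma> \<Delta> A p q) (\<Gamma> @ \<Delta>) ws)"
    proof cases
      case 1
      then show ?thesis
        using ws(1,2) by (intro disj_I_eq[OF concl 11(6) F[of i]]) (auto simp: nth_append intro!: QF_hyp)
    next
      case 2
      then show ?thesis
        using ws(1-3)
        by (intro disj_I_eq[OF concl 11(6) F[of "length \<Gamma> + j"]]) (auto simp: nth_append intro!: QF_hyp)
    next
      case 3
      have \<Sigma>: "?\<Sigma> = {W A (F E p (us @ [a]) (length \<Gamma>)) a, Neg (W A (h \<bullet> a) a)}"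
        using 3 ws(2,3) by (simp add: nth_append r_def[symmetric] a_def[symmetric])
      show ?thesis
        unfolding \<Sigma>
      proof (rule QF_negE[OF _ _ main(2) wf_disj[OF concl 11(6)]])
        show "QF L {W A (F E p (us @ [a]) (length \<Gamma>)) a, Neg (W A (h \<bullet> a) a)} (W A (h \<bullet> a) a)"
          by (rule QF_weaken[OF main(1)]) simp
      qed (simp add: QF_hyp)
    qed
  qed
qed

end

theorem theorem1:
  fixes L :: "('f, 'r) vocab"
    and E :: "('f, 'r) fm \<Rightarrow> ('f, 'r) trm"
    and p :: "('f, 'r) deriv"
    and A :: "('f, 'r) fm list"
    and u :: "('f, 'r) trm list"
  assumes "vocabulary L"
    and "\<And>B. wff L [] B \<Longrightarrow> closed_of_type L (E B) (pos B)"
    and "proof_of L p A" and "regular p"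
    and "length u = length A"
    and "\<And>i. i < length A \<Longrightarrow> closed_of_type L (u ! i) (neg (A ! i))"
  shows "QF L {} (Disj (map (\<lambda>i. W (A ! i) (F E p u i) (u ! i)) [0..<length A]))"
proof -
  interpret inhabited L E
    using assms(2) by unfold_locales
  \<comment> \<open>Closed arguments meet no eigenvariable, so they fall under the version for open
    arguments.\<close>
  have "wts L [] u A" "fvs u \<inter> eigs p = {}"
    using assms(5,6) by (auto simp: list_all2_conv_all_nth closed_of_type_def in_set_conv_nth)
  from sound[OF assms(3,4) this] show ?thesis .
qed

end
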